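(* For a metrizable space $X$ the following conditions are equivalent: (i) no closed subspace of $X$ is homeomorphic to the space $\mathbb{Q}$ of rational numbers; (ii) $X$ is a completely Baire space; (iii) the $\mathbf{\Delta}^0_2(X)$-sets coincide with the resolvable sets in $X$, i.e. a subset of $X$ is a $\mathbf{\Delta}^0_2$-set in $X$ if and only if it is resolvable in $X$.
   Context: A topological space $X$ is a Baire space if the intersection of countably many dense open sets in $X$ is dense. A space $X$ is completely Baire if every closed subspace of $X$ is a Baire space. A $\mathbf{\Delta}^0_2$-set in $X$ is a subset of $X$ that is both $F_\sigma$ and $G_\delta$ in $X$. A subset $E$ of a space $X$ is resolvable if it can be represented as $E = (F_1 \setminus F_2) \cup (F_3 \setminus F_4) \cup \ldots \cup (F_\xi \setminus F_{\xi+1}) \cup \ldots$, where $\langle F_\xi \rangle$ is a decreasing transfinite sequence of closed sets in $X$. Equivalently (indexing from $0$), there are an ordinal $\kappa$ and a decreasing sequence $\langle F_\xi \colon \xi < \kappa\rangle$ of closed sets such that $E$ is the union of $F_\xi \setminus F_{\xi+1}$ over all even ordinals $\xi$ with $\xi+1<\kappa$ (an ordinal is even if it has the form $\lambda + 2n$ with $\lambda$ zero or a limit ordinal and $n<\omega$). *)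

theory Defs
  imports "HOL-Analysis.Analysis"
begin

definition Baire_space :: "'a topology \<Rightarrow> bool" where
  "Baire_space X \<longleftrightarrow>
     (\<forall>\<G>. countable \<G> \<and> (\<forall>G\<in>\<G>. openin X G \<and> X closure_of G = topspace X)
        \<longrightarrow> X closure_of (topspace X \<inter> \<Inter>\<G>) = topspace X)"

definition completely_Baire :: "'a topology \<Rightarrow> bool" where
  "completely_Baire X \<longleftrightarrow> (\<forall>C. closedin X C \<longrightarrow> Baire_space (subtopology X C))"

definition delta02_in :: "'a topology \<Rightarrow> 'a set \<Rightarrow> bool" where
  "delta02_in X E \<longleftrightarrow> fsigma_in X E \<and> gdelta_in X E"

(* An ordinal \<kappa> is represented by a well-order r of order type \<kappa>; the elements of Field r
   stand for the ordinals below \<kappa>. *)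

definition is_suc :: "'i rel \<Rightarrow> 'i \<Rightarrow> 'i \<Rightarrow> bool" where
  "is_suc r \<xi> \<eta> \<longleftrightarrow> \<xi> \<in> Field r \<and> \<eta> \<in> Field r \<and> underS r \<eta> = under r \<xi>"

(* \<lambda> + 2n, where the ordinals \<lambda> that are zero or limits are exactly the non-successors *)
inductive even_ord :: "'i rel \<Rightarrow> 'i \<Rightarrow> bool" for r where
  zero_or_limit: "\<xi> \<in> Field r \<Longrightarrow> \<forall>\<eta>. \<not> is_suc r \<eta> \<xi> \<Longrightarrow> even_ord r \<xi>"
| plus_two: "even_ord r \<xi> \<Longrightarrow> is_suc r \<xi> \<eta> \<Longrightarrow> is_suc r \<eta> \<zeta> \<Longrightarrow> even_ord r \<zeta>"

definition resolution :: "'a topology \<Rightarrow> 'i rel \<Rightarrow> ('i \<Rightarrow> 'a set) \<Rightarrow> 'a set \<Rightarrow> bool" where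
  "resolution X r F E \<longleftrightarrow>
     Well_order r \<and>
     (\<forall>\<xi>\<in>Field r. closedin X (F \<xi>)) \<and>
     (\<forall>\<xi> \<eta>. (\<xi>, \<eta>) \<in> r \<longrightarrow> F \<eta> \<subseteq> F \<xi>) \<and>
     E = \<Union>{F \<xi> - F \<eta> | \<xi> \<eta>. even_ord r \<xi> \<and> is_suc r \<xi> \<eta>}"

(* A definition cannot quantify over all ordinals, so \<kappa> ranges over the order types of
   well-orders on subsets of 'a \<times> bool. This is no restriction: by resolution_imp_resolvable_in
   below, a resolution of arbitrary length (indexed by any type) can be replaced by one of
   this kind. *)
definition resolvable_in :: "'a topology \<Rightarrow> 'a set \<Rightarrow> bool" where
  "resolvable_in X E \<longleftrightarrow> (\<exists>(r :: ('a \<times> bool) rel) F. resolution X r F E)"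

lemma is_suc_iff:
  assumes "Well_order r"
  shows "is_suc r \<xi> \<eta> \<longleftrightarrow>
    (\<xi>, \<eta>) \<in> r \<and> \<xi> \<noteq> \<eta> \<and> (\<forall>\<zeta>. (\<zeta>, \<eta>) \<in> r \<longrightarrow> \<zeta> = \<eta> \<or> (\<zeta>, \<xi>) \<in> r)"
proof -
  have refl: "\<And>x. x \<in> Field r \<Longrightarrow> (x, x) \<in> r"
    and tr: "trans r" and anti: "antisym r"
    using assms by (auto simp: order_on_defs refl_on_def)
  show ?thesis
    unfolding is_suc_def under_def underS_def
    by (auto simp: set_eq_iff FieldI1 FieldI2 intro: refl dest: transD[OF tr] antisymD[OF anti])
qed

lemma pred_unique:
  assumes "Well_order r" "is_suc r \<xi> \<zeta>" "is_suc r \<eta> \<zeta>"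
  shows "\<xi> = \<eta>"
  using assms antisymD[of r \<xi> \<eta>] by (auto simp: is_suc_iff order_on_defs)

lemma suc_unique:
  assumes "Well_order r" "is_suc r \<xi> \<eta>" "is_suc r \<xi> \<eta>'"
  shows "\<eta> = \<eta>'"
proof (rule ccontr)
  assume "\<eta> \<noteq> \<eta>'"
  moreover have "\<eta> \<in> Field r" "\<eta>' \<in> Field r" "total_on (Field r) r"
    using assms by (auto simp: order_on_defs is_suc_def)
  ultimately have "\<eta> \<in> underS r \<eta>' \<or> \<eta>' \<in> underS r \<eta>"
    unfolding total_on_def underS_def by blast
  then show False using assms by (auto simp: is_suc_def underS_def)
qed

(* Only the pairs with F \<xi> \<noteq> F (\<xi> + 1), \<xi> even, contribute to E, and these differences are
   disjoint; picking a point in each of them embeds the set of these \<xi> into 'a. *)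
lemma resolution_imp_resolvable_in:
  fixes X :: "'a topology" and r :: "'i rel"
  assumes "resolution X r F E"
  shows "resolvable_in X E"
proof -
  have wo: "Well_order r" and clo: "\<And>\<xi>. \<xi> \<in> Field r \<Longrightarrow> closedin X (F \<xi>)"
    and dec: "\<And>\<xi> \<eta>. (\<xi>, \<eta>) \<in> r \<Longrightarrow> F \<eta> \<subseteq> F \<xi>"
    and E: "E = \<Union>{F \<xi> - F \<eta> | \<xi> \<eta>. even_ord r \<xi> \<and> is_suc r \<xi> \<eta>}"
    using assms by (auto simp: resolution_def)
  have refl: "\<And>x. x \<in> Field r \<Longrightarrow> (x, x) \<in> r" and tr: "trans r" and anti: "antisym r"
    using wo by (auto simp: order_on_defs refl_on_def)
  have tot: "(x, y) \<in> r \<or> (y, x) \<in> r" if "x \<in> Field r" "y \<in> Field r" for x y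
    using wo refl that unfolding order_on_defs total_on_def by metis
  have wf: "wf (r - Id)" using wo by (simp add: well_order_on_def)
  define P where "P a \<xi> \<eta> \<longleftrightarrow> even_ord r \<xi> \<and> is_suc r \<xi> \<eta> \<and> a \<in> F \<xi> - F \<eta>" for a \<xi> \<eta>
  have lt: "(\<eta>, \<xi>') \<in> r" if "is_suc r \<xi> \<eta>" "(\<xi>, \<xi>') \<in> r" "\<xi> \<noteq> \<xi>'" for \<xi> \<eta> \<xi>'
  proof -
    have "\<eta> \<in> Field r" "\<xi>' \<in> Field r" using that by (auto simp: is_suc_def FieldI2)
    moreover have "(\<xi>', \<xi>) \<notin> r" using that antisymD[OF anti] by blast
    ultimately show ?thesis using that(1) tot refl by (metis wo is_suc_iff)
  qed
  have P_unique: "\<xi> = \<xi>'" if "P a \<xi> \<eta>" "P a \<xi>' \<eta>'" for a \<xi> \<eta> \<xi>' \<eta>'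
  proof (rule ccontr)
    assume ne: "\<xi> \<noteq> \<xi>'"
    have *: "\<xi> \<in> Field r" "\<xi>' \<in> Field r" using that by (auto simp: P_def is_suc_def)
    show False using tot[OF *]
      using lt[of \<xi> \<eta> \<xi>'] lt[of \<xi>' \<eta>' \<xi>] dec that ne unfolding P_def by blast
  qed
  define D where "D = {\<xi>. \<exists>a \<eta>. P a \<xi> \<eta>}"
  define p where "p \<xi> = (SOME a. \<exists>\<eta>. P a \<xi> \<eta>)" for \<xi>
  define sc where "sc \<xi> = (THE \<eta>. is_suc r \<xi> \<eta>)" for \<xi>
  have p: "P (p \<xi>) \<xi> (sc \<xi>)" if "\<xi> \<in> D" for \<xi>
  proof -
    have "\<exists>\<eta>. P (p \<xi>) \<xi> \<eta>" unfolding p_def by (rule someI_ex) (use that D_def in blast)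
    moreover have "sc \<xi> = \<eta>" if "is_suc r \<xi> \<eta>" for \<eta>
      unfolding sc_def using that suc_unique[OF wo] by blast
    ultimately show ?thesis by (auto simp: P_def)
  qed
  have inj: "inj_on p D" by (metis P_unique inj_onI p)
  define g where "g = the_inv_into D p"
  have gp: "g (p \<xi>) = \<xi>" if "\<xi> \<in> D" for \<xi> using that inj by (simp add: g_def the_inv_into_f_f)
  have DF: "D \<subseteq> Field r" by (auto simp: D_def P_def is_suc_def)
  define s :: "('a \<times> bool) rel" where
    "s = {((p \<xi>, i), (p \<eta>, j)) | \<xi> \<eta> i j. \<xi> \<in> D \<and> \<eta> \<in> D \<and> (\<xi>, \<eta>) \<in> r \<and> (\<xi> = \<eta> \<longrightarrow> i \<le> j)}"
  have s_iff: "((p \<xi>, i), (p \<eta>, j)) \<in> s \<longleftrightarrow> (\<xi>, \<eta>) \<in> r \<and> (\<xi> = \<eta> \<longrightarrow> i \<le> j)"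
    if "\<xi> \<in> D" "\<eta> \<in> D" for \<xi> \<eta> i j
    unfolding s_def using that inj by (auto simp: inj_on_eq_iff)
  have sD: "\<exists>\<xi> \<eta> i j. x = (p \<xi>, i) \<and> y = (p \<eta>, j) \<and> \<xi> \<in> D \<and> \<eta> \<in> D" if "(x, y) \<in> s" for x y
    using that unfolding s_def by blast
  have FS: "Field s = p ` D \<times> UNIV"
  proof -
    have "((p \<xi>, i), (p \<xi>, i)) \<in> s" if "\<xi> \<in> D" for \<xi> i
      using that DF refl by (auto simp: s_iff)
    then have "p ` D \<times> UNIV \<subseteq> Field s" by (auto intro: FieldI1)
    moreover have "x \<in> p ` D \<times> UNIV" if "x \<in> Field s" for x
    proof -
      obtain y where "(x, y) \<in> s \<or> (y, x) \<in> s" using \<open>x \<in> Field s\<close> unfolding Field_def by blast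
      then show ?thesis using sD[of x y] sD[of y x] by auto
    qed
    ultimately show ?thesis by blast
  qed
  have wos: "Well_order s"
    unfolding well_order_on_def linear_order_on_def partial_order_on_def preorder_on_def
  proof (intro conjI)
    show "refl_on (Field s) s"
      using DF refl by (auto simp: refl_on_def FS s_iff)
    show "s \<subseteq> Field s \<times> Field s" by (auto simp: FieldI1 FieldI2)
    show "trans s"
    proof (rule transI)
      fix x y z assume a: "(x, y) \<in> s" "(y, z) \<in> s"
      obtain \<xi> \<eta> i j where "x = (p \<xi>, i)" "y = (p \<eta>, j)" "\<xi> \<in> D" "\<eta> \<in> D"
        using sD[OF a(1)] by blast
      moreover obtain \<zeta> k where "z = (p \<zeta>, k)" "\<zeta> \<in> D"
        using sD[OF a(2)] by blast
      ultimately show "(x, z) \<in> s" using a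
        by (auto simp: s_iff dest: transD[OF tr] antisymD[OF anti])
    qed
    show "antisym s"
    proof (rule antisymI)
      fix x y assume a: "(x, y) \<in> s" "(y, x) \<in> s"
      obtain \<xi> \<eta> i j where "x = (p \<xi>, i)" "y = (p \<eta>, j)" "\<xi> \<in> D" "\<eta> \<in> D"
        using sD[OF a(1)] by blast
      then show "x = y" using a by (auto simp: s_iff dest: antisymD[OF anti])
    qed
    show "total_on (Field s) s"
      unfolding total_on_def FS using tot DF by (auto simp: s_iff)
    have "s - Id \<subseteq> inv_image ((r - Id) <*lex*> {(False, True)}) (\<lambda>x. (g (fst x), snd x))"
    proof
      fix q assume "q \<in> s - Id"
      then obtain \<xi> \<eta> i j where "q = ((p \<xi>, i), (p \<eta>, j))" "\<xi> \<in> D" "\<eta> \<in> D"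
         "(\<xi>, \<eta>) \<in> r" "\<xi> = \<eta> \<longrightarrow> i \<le> j" "\<xi> = \<eta> \<longrightarrow> i \<noteq> j"
        by (auto simp: s_def)
      then show "q \<in> inv_image ((r - Id) <*lex*> {(False, True)}) (\<lambda>x. (g (fst x), snd x))"
        by (auto simp: gp)
    qed
    moreover have "wf {(False, True)}" by (intro wf_insert[THEN iffD2]) auto
    ultimately show "wf (s - Id)"
      using wf_subset wf_inv_image wf_lex_prod[OF wf] by metis
  qed
  have suc_s: "is_suc s (p \<xi>, False) (p \<xi>, True)" if "\<xi> \<in> D" for \<xi>
    unfolding is_suc_iff[OF wos]
  proof (intro conjI allI impI)
    show "((p \<xi>, False), (p \<xi>, True)) \<in> s" using that DF refl by (auto simp: s_iff)
    fix z assume z: "(z, (p \<xi>, True)) \<in> s"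
    then obtain \<zeta> k where "z = (p \<zeta>, k)" "\<zeta> \<in> D" using sD[OF z] by blast
    then show "z = (p \<xi>, True) \<or> (z, (p \<xi>, False)) \<in> s" using z that by (auto simp: s_iff)
  qed simp
  have suc_s_False: "y = (p \<xi>, True)" if "\<xi> \<in> D" "is_suc s (p \<xi>, False) y" for \<xi> y
    using that suc_s suc_unique[OF wos] by blast
  have suc_to_False: "\<exists>\<zeta>\<in>D. y = (p \<zeta>, True) \<and> (\<zeta>, \<xi>) \<in> r - Id"
    if xi: "\<xi> \<in> D" and y: "is_suc s y (p \<xi>, False)" for \<xi> y
  proof -
    have ys: "(y, (p \<xi>, False)) \<in> s" and yne: "y \<noteq> (p \<xi>, False)"
      using y by (auto simp: is_suc_iff[OF wos])
    obtain \<zeta> k where z: "y = (p \<zeta>, k)" "\<zeta> \<in> D" using sD[OF ys] by blast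
    have r: "(\<zeta>, \<xi>) \<in> r" "\<zeta> \<noteq> \<xi>" using ys yne z xi by (auto simp: s_iff)
    have "k"
    proof (rule ccontr)
      assume "\<not> k"
      then have "(p \<xi>, False) = (p \<zeta>, True)" using suc_s_False[of \<zeta>] z y by simp
      then show False by simp
    qed
    then show ?thesis using z r by auto
  qed
  have even_s: "\<xi> \<in> D \<longrightarrow> even_ord s (p \<xi>, False) \<and> \<not> even_ord s (p \<xi>, True)" for \<xi>
  proof (rule wf_induct_rule[OF wf, of _ \<xi>], intro impI conjI)
    fix \<xi> assume IH: "\<And>\<zeta>. (\<zeta>, \<xi>) \<in> r - Id \<Longrightarrow>
        \<zeta> \<in> D \<longrightarrow> even_ord s (p \<zeta>, False) \<and> \<not> even_ord s (p \<zeta>, True)"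
      and xi: "\<xi> \<in> D"
    show "even_ord s (p \<xi>, False)"
    proof (cases "\<exists>y. is_suc s y (p \<xi>, False)")
      case False
      then show ?thesis using xi by (auto intro!: zero_or_limit simp: FS)
    next
      case True
      then obtain y where y: "is_suc s y (p \<xi>, False)" by blast
      then obtain \<zeta> where z: "\<zeta> \<in> D" "y = (p \<zeta>, True)" "(\<zeta>, \<xi>) \<in> r - Id"
        using suc_to_False[OF xi] by blast
      then show ?thesis using IH suc_s y plus_two by metis
    qed
    show "\<not> even_ord s (p \<xi>, True)"
    proof
      assume "even_ord s (p \<xi>, True)"
      then show False
      proof cases
        case zero_or_limit
        then show False using suc_s[OF xi] by blast
      next
        case (plus_two a b)
        then have "b = (p \<xi>, False)" using pred_unique[OF wos] suc_s[OF xi] by blast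
        then obtain \<zeta> where "\<zeta> \<in> D" "a = (p \<zeta>, True)" "(\<zeta>, \<xi>) \<in> r - Id"
          using suc_to_False[OF xi] plus_two by blast
        then show False using IH plus_two by blast
      qed
    qed
  qed
  define G where "G x = (if snd x then F (sc (g (fst x))) else F (g (fst x)))" for x :: "'a \<times> bool"
  have G: "G (p \<xi>, True) = F (sc \<xi>)" "G (p \<xi>, False) = F \<xi>" if "\<xi> \<in> D" for \<xi>
    using that by (auto simp: G_def gp)
  have sc: "is_suc r \<xi> (sc \<xi>)" "(\<xi>, sc \<xi>) \<in> r" if "\<xi> \<in> D" for \<xi>
    using p[OF that] wo by (auto simp: P_def is_suc_iff)
  have "resolution X s G E"
    unfolding resolution_def
  proof (intro conjI ballI allI impI)
    show "Well_order s" by (fact wos)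
    show "closedin X (G x)" if "x \<in> Field s" for x
    proof -
      obtain \<xi> i where x: "x = (p \<xi>, i)" "\<xi> \<in> D" using \<open>x \<in> Field s\<close> by (auto simp: FS)
      show ?thesis using x sc[OF x(2)] clo by (cases i) (auto simp: G is_suc_def)
    qed
    show "G y \<subseteq> G x" if xy: "(x, y) \<in> s" for x y
    proof -
      obtain \<xi> i \<eta> j where x: "x = (p \<xi>, i)" "\<xi> \<in> D" and y: "y = (p \<eta>, j)" "\<eta> \<in> D"
        using sD[OF xy] by blast
      have 1: "(\<xi>, \<eta>) \<in> r" "\<xi> = \<eta> \<longrightarrow> i \<le> j" using xy x y by (auto simp: s_iff)
      show ?thesis
      proof (cases "\<xi> = \<eta>")
        case True
        then show ?thesis using 1 x y dec[OF sc(2)[OF x(2)]] by (cases i; cases j) (auto simp: G)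
      next
        case False
        have "G y \<subseteq> F \<eta>" using y dec[OF sc(2)[OF y(2)]] by (cases j) (auto simp: G)
        also have "\<dots> \<subseteq> F (sc \<xi>)" using dec lt[OF sc(1)[OF x(2)]] 1 False by blast
        also have "\<dots> \<subseteq> G x" using x dec[OF sc(2)[OF x(2)]] by (cases i) (auto simp: G)
        finally show ?thesis .
      qed
    qed
    show "E = \<Union>{G x - G y | x y. even_ord s x \<and> is_suc s x y}"
    proof (intro equalityI subsetI)
      fix a assume "a \<in> E"
      then obtain \<xi> \<eta> where a: "P a \<xi> \<eta>" unfolding E P_def by blast
      then have D: "\<xi> \<in> D" by (auto simp: D_def)
      have "\<eta> = sc \<xi>" using a sc(1)[OF D] suc_unique[OF wo] by (auto simp: P_def)
      then have "a \<in> G (p \<xi>, False) - G (p \<xi>, True)" using a D by (auto simp: P_def G)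
      then show "a \<in> \<Union>{G x - G y | x y. even_ord s x \<and> is_suc s x y}"
        using even_s D suc_s by blast
    next
      fix a assume "a \<in> \<Union>{G x - G y | x y. even_ord s x \<and> is_suc s x y}"
      then obtain x y where a: "a \<in> G x - G y" and x: "even_ord s x" and y: "is_suc s x y" by blast
      obtain \<xi> i where xi: "x = (p \<xi>, i)" "\<xi> \<in> D" using y by (auto simp: is_suc_def FS)
      then have "\<not> i" using even_s x by (cases i) auto
      then have "y = (p \<xi>, True)" using suc_s_False y xi by auto
      then have "a \<in> F \<xi> - F (sc \<xi>)" using a xi \<open>\<not> i\<close> by (auto simp: G)
      moreover have "even_ord r \<xi>" using p[OF xi(2)] by (auto simp: P_def)
      ultimately show "a \<in> E" unfolding E using sc(1)[OF xi(2)] by blast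
    qed
  qed
  then show ?thesis unfolding resolvable_in_def by blast
qed

end

theory Submission
  imports Defs
begin

text \<open>
  If \<open>X\<close> is not completely Baire, some nonempty closed set \<open>Y\<close> is a countable union of closed nowhere
  dense subsets of itself, and Hurewicz's construction yields a nonempty countable closed set
  \<open>D \<subseteq> Y\<close> without isolated points. By Sierpinski's theorem \<open>D\<close> is homeomorphic to \<open>\<rat>\<close>: both are
  coded by the binary sequences with finitely many ones. Splitting \<open>D\<close> by the parity of the number
  of ones gives a set \<open>E\<close> such that \<open>E\<close> and \<open>D - E\<close> are countable and dense in \<open>D\<close>; it is
  \<open>\<Delta>\<^sup>0\<^sub>2\<close> but not resolvable, since every nonempty set has a nonempty relatively open part on which a
  resolvable set is trivial. Conversely, in a completely Baire space a \<open>\<Delta>\<^sup>0\<^sub>2\<close> set is trivial on a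
  nonempty relatively open part of every nonempty closed set; removing such parts transfinitely
  resolves it. Resolvable sets in a metrizable space are always \<open>\<Delta>\<^sup>0\<^sub>2\<close>.
\<close>

section \<open>Countable metrizable spaces without isolated points\<close>

text \<open>Viewed as a subspace of the Cantor space, this set is a model of the rationals.\<close>

definition fin_seqs :: "(nat \<Rightarrow> bool) set" where
  "fin_seqs = {\<beta>. finite {i. \<beta> i}}"

text \<open>This makes \<open>b\<close> a homeomorphism onto \<open>fin_seqs\<close> with the
  topology of the Cantor space: the points whose codes share the first \<open>n\<close> digits with
  the code of \<open>x\<close> form its basic neighbourhoods.\<close>

definition seq_coding :: "'a topology \<Rightarrow> ('a \<Rightarrow> nat \<Rightarrow> bool) \<Rightarrow> bool" where
  "seq_coding X b \<longleftrightarrow> bij_betw b (topspace X) fin_seqs \<and>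
     (\<forall>U. openin X U \<longleftrightarrow> U \<subseteq> topspace X \<and>
        (\<forall>x\<in>U. \<exists>n. \<forall>y\<in>topspace X. (\<forall>i<n. b y i = b x i) \<longrightarrow> y \<in> U))"

lemma seq_coding_openD:
  assumes "seq_coding X b" "openin X U" "x \<in> U"
  shows "\<exists>n. \<forall>y\<in>topspace X. (\<forall>i<n. b y i = b x i) \<longrightarrow> y \<in> U"
  using assms by (simp add: seq_coding_def)

text \<open>Both codings have the same range, so a point of \<open>Y\<close> whose code shares
  \<open>n\<close> digits with that of the image of \<open>x\<close> comes from a point of
  \<open>X\<close> whose code shares \<open>n\<close> digits with that of \<open>x\<close>. The
  inverse map has the same form with the codings exchanged, so openness follows in both
  directions.\<close>

lemma seq_coding_open_map:
  assumes X: "seq_coding X b" and Y: "seq_coding Y c"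
  shows "open_map X Y (the_inv_into (topspace Y) c \<circ> b)"
  unfolding open_map_def
proof (intro allI impI)
  define h where "h = the_inv_into (topspace Y) c \<circ> b"
  have bb: "bij_betw b (topspace X) fin_seqs" and bc: "bij_betw c (topspace Y) fin_seqs"
    using X Y by (auto simp: seq_coding_def)
  have h: "h x \<in> topspace Y" "c (h x) = b x" if "x \<in> topspace X" for x
  proof -
    have bx: "b x \<in> fin_seqs" using bb that by (auto simp: bij_betw_def)
    show "h x \<in> topspace Y" unfolding h_def o_def
      using bij_betw_the_inv_into[OF bc] bx by (auto simp: bij_betw_def)
    show "c (h x) = b x" using f_the_inv_into_f_bij_betw[OF bc, of "b x"] bx by (simp add: h_def)
  qed
  fix U assume U: "openin X U"
  have sub: "U \<subseteq> topspace X" using U by (rule openin_subset)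
  have "\<exists>n. \<forall>y\<in>topspace Y. (\<forall>i<n. c y i = c (h x) i) \<longrightarrow> y \<in> h ` U" if x: "x \<in> U" for x
  proof -
    obtain n where n: "\<And>y. y \<in> topspace X \<Longrightarrow> (\<forall>i<n. b y i = b x i) \<Longrightarrow> y \<in> U"
      using seq_coding_openD[OF X U x] by metis
    have "y \<in> h ` U" if y: "y \<in> topspace Y" "\<forall>i<n. c y i = c (h x) i" for y
    proof -
      have "c y \<in> fin_seqs" using y bc by (auto simp: bij_betw_def)
      then obtain z where z: "z \<in> topspace X" "b z = c y"
        using bij_betw_imp_surj_on[OF bb] by (metis imageE)
      have "h z = y" using h[OF z(1)] y(1) z(2) bc by (auto simp: bij_betw_def inj_on_def)
      moreover have "z \<in> U" using n[OF z(1)] y(2) z(2) h(2)[of x] x sub by auto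
      ultimately show ?thesis by blast
    qed
    then show ?thesis by blast
  qed
  then show "openin Y ((the_inv_into (topspace Y) c \<circ> b) ` U)"
    using Y h(1) sub unfolding seq_coding_def h_def[symmetric] by auto
qed

lemma seq_coding_homeomorphic:
  assumes X: "seq_coding X b" and Y: "seq_coding Y c"
  shows "X homeomorphic_space Y"
proof -
  define h where "h = the_inv_into (topspace Y) c \<circ> b"
  define k where "k = the_inv_into (topspace X) b \<circ> c"
  have bb: "bij_betw b (topspace X) fin_seqs" and bc: "bij_betw c (topspace Y) fin_seqs"
    using X Y by (auto simp: seq_coding_def)
  have "open_map X Y h" "open_map Y X k"
    unfolding h_def k_def using seq_coding_open_map X Y by blast+
  moreover have h: "bij_betw h (topspace X) (topspace Y)"
    unfolding h_def using bb bij_betw_the_inv_into[OF bc] by (rule bij_betw_trans)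
  moreover have hk: "k (h x) = x" if "x \<in> topspace X" for x
  proof -
    have "b x \<in> fin_seqs" using bb that by (auto simp: bij_betw_def)
    then have "c (h x) = b x" using f_the_inv_into_f_bij_betw[OF bc, of "b x"] by (simp add: h_def)
    then show ?thesis using bb that by (simp add: k_def the_inv_into_f_f bij_betw_def)
  qed
  moreover have "h (k y) = y" if "y \<in> topspace Y" for y
  proof -
    have "y \<in> h ` topspace X" using that unfolding bij_betw_imp_surj_on[OF h] .
    then obtain x where "x \<in> topspace X" "y = h x" by (rule imageE)
    then show ?thesis using hk by simp
  qed
  \<comment> \<open>Continuity of \<open>h\<close> is openness of its inverse
    \<open>k\<close>.\<close>
  ultimately have "continuous_map X Y h"
  proof -
    assume a: "open_map Y X k" "bij_betw h (topspace X) (topspace Y)" "\<And>y. y \<in> topspace Y \<Longrightarrow> h (k y) = y"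
      "\<And>x. x \<in> topspace X \<Longrightarrow> k (h x) = x"
    show ?thesis unfolding continuous_map_def
    proof (intro conjI allI impI)
      show "h \<in> topspace X \<rightarrow> topspace Y" using a(2) by (auto simp: bij_betw_def)
      fix U assume U: "openin Y U"
      have "{x \<in> topspace X. h x \<in> U} = k ` U"
      proof (intro set_eqI iffI)
        fix x assume "x \<in> {x \<in> topspace X. h x \<in> U}"
        then show "x \<in> k ` U" using a(4)[of x] by force
      next
        fix x assume "x \<in> k ` U"
        moreover have "k ` U \<subseteq> topspace X" using a(1) U openin_subset by (fastforce simp: open_map_def)
        ultimately show "x \<in> {x \<in> topspace X. h x \<in> U}"
          using a(3) openin_subset[OF U] by auto
      qed
      then show "openin X {x \<in> topspace X. h x \<in> U}" using a(1) U by (simp add: open_map_def)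
    qed
  qed
  then have "homeomorphic_map X Y h"
    using \<open>open_map X Y h\<close> h by (intro bijective_open_imp_homeomorphic_map) (auto simp: bij_betw_def)
  then show ?thesis by (rule homeomorphic_map_imp_homeomorphic_space)
qed

section \<open>Sierpinski's theorem: codings of countable metrizable spaces without isolated
  points\<close>

lemma (in Metric_space) clopen_mball:
  assumes "countable M" "p \<in> M" "0 < \<epsilon>"
  obtains \<rho> where "0 < \<rho>" "\<rho> < \<epsilon>" "openin mtopology (mball p \<rho>)" "closedin mtopology (mball p \<rho>)"
proof -
  \<comment> \<open>Only countably many radii occur as distances from \<open>p\<close>. At any other
    radius the open and the closed ball coincide.\<close>
  have "uncountable ({0<..<\<epsilon>} - d p ` M)"
    using assms by (intro uncountable_minus_countable) (auto simp: uncountable_open_interval)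
  then obtain \<rho> where \<rho>: "\<rho> \<in> {0<..<\<epsilon>}" "\<rho> \<notin> d p ` M"
    by (metis Diff_iff countable_empty equals0I)
  have "mball p \<rho> = mcball p \<rho>" using \<rho>(2) by (force simp: mball_def mcball_def)
  then have "closedin mtopology (mball p \<rho>)" by simp
  then show thesis using \<rho>(1) that by auto
qed

text \<open>A binary splitting scheme: the half \<open>Z A n\<close> of \<open>A\<close> with digit \<open>False\<close> is a small clopen set
  containing the point \<open>p A\<close> of least index. Each digit \<open>True\<close> on the branch of \<open>x\<close> increases the
  index of \<open>p A\<close>, which stays below that of \<open>x\<close>, so that only finitely many digits are \<open>True\<close>; along
  digits \<open>False\<close> the point \<open>p A\<close> stays fixed and the sets shrink to it.\<close>

lemma (in Metric_space) seq_coding_exists: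
  assumes cM: "countable M" and ne: "M \<noteq> {}"
    and perfect: "\<And>x. x \<in> M \<Longrightarrow> \<not> openin mtopology {x}"
  shows "\<exists>b. seq_coding mtopology b"
proof -
  define idx where "idx = to_nat_on M"
  have idx: "inj_on idx M" using cM unfolding idx_def by (rule inj_on_to_nat_on)
  define p where "p A = arg_min idx (\<lambda>x. x \<in> A)" for A
  have pin: "p A \<in> A" if "A \<noteq> {}" for A
    using that arg_min_natI[of "\<lambda>x. x \<in> A"] unfolding p_def by blast
  have ple: "idx (p A) \<le> idx x" if "x \<in> A" for A x
    using that unfolding p_def by (rule arg_min_nat_le)
  have peq: "p B = p A" if "B \<subseteq> A" "p A \<in> B" "A \<subseteq> M" for A B
  proof -
    have "p B \<in> B" using that(2) pin by blast
    then have "idx (p B) = idx (p A)" using ple[OF that(2)] ple[of "p B" A] that(1) by auto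
    then show ?thesis using inj_onD[OF idx, of "p B" "p A"] \<open>p B \<in> B\<close> that by blast
  qed
  define good where "good A \<longleftrightarrow> openin mtopology A \<and> A \<noteq> {}" for A
  have gsub: "A \<subseteq> M" if "good A" for A using that openin_subset by (force simp: good_def)
  have "\<exists>Z. good Z \<and> good (A - Z) \<and> p A \<in> Z \<and> Z \<subseteq> A \<and> Z \<subseteq> mball (p A) (1 / real (Suc n))"
    if A: "good A" for A n
  proof -
    have pA: "p A \<in> A" "p A \<in> M" using A pin gsub by (auto simp: good_def)
    have "\<exists>e>0. mball (p A) e \<subseteq> A" using A pA(1) by (simp add: good_def openin_mtopology)
    then obtain e where e: "e > 0" "mball (p A) e \<subseteq> A" by (elim exE conjE)
    have "A \<noteq> {p A}" using perfect[OF pA(2)] A by (auto simp: good_def)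
    \<comment> \<open>A second point of \<open>A\<close>. A radius below its distance from
      \<open>p A\<close> leaves it outside the ball, so that the other half is nonempty too.\<close>
    then obtain y where y: "y \<in> A" "y \<noteq> p A" using pA by blast
    have "0 < d (p A) y" using y pA gsub[OF A] by auto
    then obtain \<rho> where \<rho>: "0 < \<rho>" "\<rho> < min e (min (d (p A) y) (1 / real (Suc n)))"
      "openin mtopology (mball (p A) \<rho>)" "closedin mtopology (mball (p A) \<rho>)"
      using clopen_mball[OF cM pA(2)] e(1) by (metis (no_types) divide_pos_pos min_less_iff_conj of_nat_0_less_iff zero_less_Suc zero_less_one)
    have "mball (p A) \<rho> \<subseteq> A" using e(2) \<rho>(2) mball_subset_concentric[of \<rho> e] by auto
    moreover have "p A \<in> mball (p A) \<rho>" using pA \<rho>(1) by simp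
    moreover have "y \<in> A - mball (p A) \<rho>" using y \<rho>(2) by auto
    moreover have "openin mtopology (A - mball (p A) \<rho>)"
      using A \<rho>(4) by (auto simp: good_def openin_diff)
    moreover have "mball (p A) \<rho> \<subseteq> mball (p A) (1 / real (Suc n))"
      using \<rho>(2) by (intro mball_subset_concentric) auto
    ultimately show ?thesis using \<rho>(3) unfolding good_def by blast
  qed
  then obtain Z where Z: "good A \<Longrightarrow> good (Z A n)" "good A \<Longrightarrow> good (A - Z A n)"
      "good A \<Longrightarrow> p A \<in> Z A n" "good A \<Longrightarrow> Z A n \<subseteq> A"
      "good A \<Longrightarrow> Z A n \<subseteq> mball (p A) (1 / real (Suc n))" for A n
    by metis
  define B where "B \<beta> = rec_nat M (\<lambda>n A. if \<beta> n then A - Z A n else Z A n)" for \<beta> :: "nat \<Rightarrow> bool"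
  have B0: "B \<beta> 0 = M" for \<beta> by (simp add: B_def)
  have BS: "B \<beta> (Suc n) = (if \<beta> n then B \<beta> n - Z (B \<beta> n) n else Z (B \<beta> n) n)" for \<beta> n
    by (simp add: B_def)
  have gB: "good (B \<beta> n)" for \<beta> n
  proof (induction n)
    case 0 then show ?case using ne openin_topspace[of mtopology] by (simp add: B0 good_def)
  next
    case (Suc n) then show ?case using Z(1,2) by (simp add: BS)
  qed
  have Bdec: "B \<beta> n \<subseteq> B \<beta> m" if "m \<le> n" for \<beta> m n
  proof (rule lift_Suc_antimono_le[OF _ that])
    show "B \<beta> (Suc k) \<subseteq> B \<beta> k" for k using Z(4)[OF gB, of \<beta> k k] by (auto simp: BS)
  qed
  have Bcong: "B \<beta> n = B \<gamma> n" if "\<forall>i<n. \<beta> i = \<gamma> i" for \<beta> \<gamma> n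
    using that by (induction n) (auto simp: B0 BS)
  have Binter: "\<forall>i<n. \<beta> i = \<gamma> i" if "x \<in> B \<beta> n" "x \<in> B \<gamma> n" for x \<beta> \<gamma> n
    using that
  proof (induction n)
    case (Suc n)
    then have x: "x \<in> B \<beta> n" "x \<in> B \<gamma> n" using Bdec[of n "Suc n"] by auto
    then have IH: "\<forall>i<n. \<beta> i = \<gamma> i" using Suc.IH by blast
    then have "B \<beta> n = B \<gamma> n" by (rule Bcong)
    then have "\<beta> n = \<gamma> n" using Suc.prems by (auto simp: BS split: if_splits)
    then show ?case using IH by (auto simp: less_Suc_eq)
  qed simp
  \<comment> \<open>The sets containing \<open>x\<close> are followed down the tree directly, since
    the branch \<open>b x\<close> is only read off from them afterwards. The fact \<open>CB\<close>
    identifies them with the sets along that branch.\<close>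
  define C where "C x = rec_nat M (\<lambda>n A. if x \<in> Z A n then Z A n else A - Z A n)" for x
  define b where "b x n \<longleftrightarrow> x \<notin> Z (C x n) n" for x n
  have CB: "C x n = B (b x) n" for x n
    by (induction n) (simp_all add: C_def B0 BS b_def)
  have b_iff: "b x n \<longleftrightarrow> x \<notin> Z (B (b x) n) n" for x n by (simp add: b_def CB)
  have inB: "x \<in> B (b x) n" if "x \<in> M" for x n
    using that by (induction n) (auto simp: B0 BS b_iff)
  have inB_iff: "y \<in> B (b x) n \<longleftrightarrow> (\<forall>i<n. b y i = b x i)" if "x \<in> M" "y \<in> M" for x y n
    using Binter Bcong inB that by blast
  have fin: "b x \<in> fin_seqs" if x: "x \<in> M" for x
  proof -
    define f where "f n = idx (p (B (b x) n))" for n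
    have pB: "p (B (b x) n) \<in> B (b x) n" "p (B (b x) n) \<in> M" for n
      using gB[of "b x" n] pin[of "B (b x) n"] gsub[of "B (b x) n"] by (auto simp: good_def)
    have mono: "f m \<le> f n" if "m \<le> n" for m n
      unfolding f_def using Bdec[OF that] pB by (intro ple) blast
    have strict: "f n < f (Suc n)" if "b x n" for n
    proof -
      have "p (B (b x) n) \<notin> B (b x) (Suc n)" using that Z(3)[OF gB] by (simp add: BS)
      then have "p (B (b x) n) \<noteq> p (B (b x) (Suc n))" using pB by metis
      then have "f n \<noteq> f (Suc n)" unfolding f_def using idx pB by (auto simp: inj_on_def)
      then show ?thesis using mono[of n "Suc n"] by simp
    qed
    have "strict_mono_on {i. b x i} f"
    proof (rule strict_mono_onI)
      fix m n assume "m \<in> {i. b x i}" "m < n"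
      then show "f m < f n" using strict[of m] mono[of "Suc m" n] by auto
    qed
    then have "inj_on f {i. b x i}" by (rule strict_mono_on_imp_inj_on)
    moreover have "f ` {i. b x i} \<subseteq> {..idx x}" unfolding f_def using ple inB[OF x] by blast
    ultimately show ?thesis unfolding fin_seqs_def
      using finite_imageD finite_subset by blast
  qed
  \<comment> \<open>Beyond the last digit \<open>True\<close> the chosen point no longer moves. This
    limit point \<open>q\<close> serves twice: it shows that every sequence in
    \<open>fin_seqs\<close> is a code, and it is the centre of the shrinking balls in
    \<open>small\<close>.\<close>
  have tail: "\<exists>q\<in>M. \<exists>N. (\<forall>n. q \<in> B \<beta> n) \<and> (\<forall>n\<ge>N. B \<beta> (Suc n) \<subseteq> mball q (1 / real (Suc n)))"
    if fs: "\<beta> \<in> fin_seqs" for \<beta>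
  proof -
    obtain N where N: "\<And>n. n \<ge> N \<Longrightarrow> \<not> \<beta> n"
      using fs unfolding fin_seqs_def by (metis finite_nat_set_iff_bounded mem_Collect_eq not_less)
    define q where "q = p (B \<beta> N)"
    have pq: "p (B \<beta> n) = q" if "n \<ge> N" for n
      using that
    proof (induction n rule: dec_induct)
      case (step n)
      have "p (B \<beta> (Suc n)) = p (B \<beta> n)"
        using N[OF step(1)] Z(3,4)[OF gB] gsub[OF gB] by (intro peq) (auto simp: BS)
      then show ?case using step by simp
    qed (simp add: q_def)
    have "q \<in> B \<beta> n" for n
    proof (cases "n \<ge> N")
      case True then show ?thesis using pq pin gB by (metis good_def)
    next
      case False then show ?thesis using Bdec[of n N \<beta>] pin gB unfolding q_def good_def by fastforce
    qed
    moreover have "B \<beta> (Suc n) \<subseteq> mball q (1 / real (Suc n))" if "n \<ge> N" for n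
      using Z(5)[OF gB, of \<beta> n n] pq[OF that] N[OF that] by (simp add: BS)
    ultimately show ?thesis using B0 by blast
  qed
  have lim: "x = y" if "x \<in> M" "y \<in> M" "\<And>n. n \<ge> N \<Longrightarrow> y \<in> mball x (1 / real (Suc n))" for x y N
  proof -
    have "d x y \<le> 0"
    proof (rule field_le_epsilon)
      fix e :: real assume "e > 0"
      then obtain n where n: "1 / real (Suc n) < e" using nat_approx_posE by blast
      have "d x y < 1 / real (Suc (max n N))" using that(3)[of "max n N"] by simp
      also have "\<dots> \<le> 1 / real (Suc n)" by (simp add: field_simps)
      finally show "d x y \<le> 0 + e" using n by simp
    qed
    then show ?thesis using that(1,2) nonneg[of x y] by simp
  qed
  \<comment> \<open>The sets along the branch of \<open>x\<close> shrink to the point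
    \<open>q\<close> from \<open>tail\<close>. As \<open>x\<close> lies in all of them,
    \<open>q\<close> is \<open>x\<close> itself.\<close>
  have small: "\<exists>N. \<forall>n\<ge>N. B (b x) (Suc n) \<subseteq> mball x (1 / real (Suc n))" if x: "x \<in> M" for x
  proof -
    obtain q N where q: "q \<in> M" and N: "\<And>n. n \<ge> N \<Longrightarrow> B (b x) (Suc n) \<subseteq> mball q (1 / real (Suc n))"
      using tail[OF fin[OF x]] by blast
    have "q = x" using lim[OF q x, of N] N inB[OF x] by blast
    then show ?thesis using N by blast
  qed
  have "inj_on b M"
  proof (rule inj_onI)
    fix x y assume xy: "x \<in> M" "y \<in> M" "b x = b y"
    obtain N where N: "\<And>n. n \<ge> N \<Longrightarrow> B (b x) (Suc n) \<subseteq> mball x (1 / real (Suc n))"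
      using small[OF xy(1)] by blast
    show "x = y" using lim[OF xy(1,2), of N] N inB[OF xy(2)] unfolding xy(3) by blast
  qed
  moreover have "b ` M = fin_seqs"
  proof
    show "b ` M \<subseteq> fin_seqs" using fin by blast
    show "fin_seqs \<subseteq> b ` M"
    proof
      fix \<beta> assume "\<beta> \<in> fin_seqs"
      then obtain q where q: "q \<in> M" "\<And>n. q \<in> B \<beta> n" using tail by blast
      have "b q n = \<beta> n" for n using Binter[OF inB[OF q(1)] q(2), of "Suc n"] by blast
      then show "\<beta> \<in> b ` M" using q(1) by blast
    qed
  qed
  moreover have "openin mtopology U \<longleftrightarrow>
      U \<subseteq> M \<and> (\<forall>x\<in>U. \<exists>n. \<forall>y\<in>M. (\<forall>i<n. b y i = b x i) \<longrightarrow> y \<in> U)" (is "_ \<longleftrightarrow> ?R") for U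
  proof
    assume U: "openin mtopology U"
    show ?R
    proof (intro conjI ballI)
      show "U \<subseteq> M" using U by (simp add: openin_mtopology)
      fix x assume x: "x \<in> U"
      then have xM: "x \<in> M" using \<open>U \<subseteq> M\<close> by blast
      obtain e where e: "e > 0" "mball x e \<subseteq> U" using U x by (auto simp: openin_mtopology)
      obtain n where n: "1 / real (Suc n) < e" using e(1) nat_approx_posE by blast
      obtain N where N: "\<And>n. n \<ge> N \<Longrightarrow> B (b x) (Suc n) \<subseteq> mball x (1 / real (Suc n))"
        using small[OF xM] by blast
      have "1 / real (Suc (max n N)) \<le> 1 / real (Suc n)" by (simp add: field_simps)
      then have "B (b x) (Suc (max n N)) \<subseteq> U"
        using N[of "max n N"] n e(2) mball_subset_concentric[of "1 / real (Suc (max n N))" e x] by auto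
      then show "\<exists>n. \<forall>y\<in>M. (\<forall>i<n. b y i = b x i) \<longrightarrow> y \<in> U" using inB_iff[OF xM] by blast
    qed
  next
    assume R: ?R
    show "openin mtopology U"
    proof (subst openin_subopen, intro ballI)
      fix x assume x: "x \<in> U"
      then obtain n where n: "\<forall>y\<in>M. (\<forall>i<n. b y i = b x i) \<longrightarrow> y \<in> U" using R by blast
      have "x \<in> M" using x R by blast
      then have "B (b x) n \<subseteq> U" using n inB_iff gsub[OF gB] by blast
      then show "\<exists>T. openin mtopology T \<and> x \<in> T \<and> T \<subseteq> U"
        using gB[of "b x" n] inB[OF \<open>x \<in> M\<close>, of n] unfolding good_def by blast
    qed
  qed
  ultimately show ?thesis by (auto simp: seq_coding_def bij_betw_def)
qed

lemma metrizable_seq_coding: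
  assumes "metrizable_space X" "countable (topspace X)" "topspace X \<noteq> {}"
    and "\<And>x. x \<in> topspace X \<Longrightarrow> \<not> openin X {x}"
  obtains b where "seq_coding X b"
proof -
  obtain M d where M: "Metric_space M d" and X: "X = Metric_space.mtopology M d"
    using assms(1) by (auto simp: metrizable_space_def)
  interpret Metric_space M d by fact
  show thesis using seq_coding_exists assms(2-4) that unfolding X by auto
qed

lemma Rats_not_isolated: "\<not> openin (top_of_set \<rat>) {x :: real}"
proof
  assume "openin (top_of_set \<rat>) {x}"
  then obtain e where e: "e > 0" "ball x e \<inter> \<rat> \<subseteq> {x}" unfolding openin_contains_ball by blast
  obtain q where q: "q \<in> \<rat>" "x < q" "q < x + e" using Rats_dense_in_real[of x "x + e"] e(1) by auto
  then have "q \<in> ball x e \<inter> \<rat>" by (simp add: dist_real_def)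
  then show False using e(2) q(2) by blast
qed

lemma Rats_seq_coding:
  obtains c where "seq_coding (top_of_set (\<rat> :: real set)) c"
proof (rule metrizable_seq_coding)
  show "metrizable_space (top_of_set (\<rat> :: real set))"
    by (simp add: metrizable_space_euclidean metrizable_space_subtopology)
  show "countable (topspace (top_of_set (\<rat> :: real set)))" by (simp add: countable_rat)
  show "topspace (top_of_set (\<rat> :: real set)) \<noteq> {}" by auto
  show "\<not> openin (top_of_set \<rat>) {x}" for x :: real by (rule Rats_not_isolated)
qed (use that in blast)

section \<open>Hurewicz's construction of a countable closed set without isolated points\<close>

lemma (in Metric_space) finite_separated:
  assumes "finite P" "P \<subseteq> M"
  obtains r where "0 < r" "\<And>p q. p \<in> P \<Longrightarrow> q \<in> P \<Longrightarrow> p \<noteq> q \<Longrightarrow> r \<le> d p q"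
proof -
  \<comment> \<open>The element 1 keeps \<open>S\<close> nonempty when \<open>P\<close> has at most
    one point, so that its minimum is meaningful.\<close>
  define S where "S = insert 1 ((\<lambda>(p, q). d p q) ` {(p, q). p \<in> P \<and> q \<in> P \<and> p \<noteq> q})"
  have "finite {(p, q). p \<in> P \<and> q \<in> P \<and> p \<noteq> q}"
    by (rule finite_subset[of _ "P \<times> P"]) (use assms in auto)
  then have fin: "finite S" by (simp add: S_def)
  show thesis
  proof
    show "0 < Min S" using fin assms(2) by (auto simp: S_def Min_gr_iff  subset_iff)
    show "Min S \<le> d p q" if "p \<in> P" "q \<in> P" "p \<noteq> q" for p q
      using fin that by (intro Min_le) (auto simp: S_def)
  qed
qed

text \<open>\<open>D\<close> is the union of finite sets \<open>P n\<close>. Every point of \<open>D\<close> is within \<open>r n\<close> of \<open>P n\<close>, and points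
  added after stage \<open>m\<close> stay away from \<open>F m\<close>. Hence for a limit \<open>y \<in> F m\<close> of \<open>D\<close> the point of
  \<open>P n\<close> near \<open>y\<close> is the same for all \<open>n \<ge> m\<close>, and so it is \<open>y\<close>.\<close>

lemma (in Metric_space) countable_perfect_closed_subset:
  assumes clY: "closedin mtopology Y" and "Y \<noteq> {}"
    and F: "\<And>n. closedin mtopology (F n)" "incseq F" and cov: "Y \<subseteq> (\<Union>n. F n)"
    and nd: "\<And>n y e. y \<in> Y \<Longrightarrow> 0 < e \<Longrightarrow> \<exists>q\<in>Y. d y q < e \<and> q \<notin> F n"
  obtains D where "D \<subseteq> Y" "D \<noteq> {}" "countable D" "closedin mtopology D"
    "\<And>x e. x \<in> D \<Longrightarrow> 0 < e \<Longrightarrow> \<exists>y\<in>D. y \<noteq> x \<and> d x y < e"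
proof -
  have Y: "Y \<subseteq> M" "Y \<noteq> {}" using assms(2) closedin_subset[OF clY] by auto
  \<comment> \<open>Since \<open>y\<close> lies in some \<open>F m\<close>, avoiding the larger of
    \<open>F m\<close> and \<open>F n\<close> also forces \<open>q\<close> to differ from
    \<open>y\<close>.\<close>
  have nd': "\<exists>q\<in>Y. d y q < e \<and> q \<notin> F n \<and> q \<noteq> y" if y: "y \<in> Y" "0 < e" for n y e
  proof -
    obtain m where m: "y \<in> F m" using cov y by blast
    obtain q where "q \<in> Y" "d y q < e" "q \<notin> F (max m n)" using nd y by blast
    moreover have "F m \<subseteq> F (max m n)" "F n \<subseteq> F (max m n)" using F(2) by (auto simp: incseq_def)
    ultimately show ?thesis using m by blast
  qed
  define ok where "ok Pr \<longleftrightarrow> finite (fst Pr) \<and> fst Pr \<subseteq> Y \<and> fst Pr \<noteq> {} \<and> 0 < snd Pr \<and>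
     (\<forall>p\<in>fst Pr. \<forall>q\<in>fst Pr. p \<noteq> q \<longrightarrow> disjnt (mcball p (snd Pr)) (mcball q (snd Pr)))" for Pr :: "'a set \<times> real"
  \<comment> \<open>A stage is a finite set with a radius. Every old point gets a close companion,
    so \<open>D\<close> will have no isolated point. The new balls lie inside old ones, so limits of
    \<open>D\<close> stay trapped in them. The balls around added points avoid \<open>F n\<close>,
    so a limit in \<open>F n\<close> can only be near an old point.\<close>
  define step where "step n Pr Qs \<longleftrightarrow> fst Pr \<subseteq> fst Qs \<and> snd Qs \<le> snd Pr / 2 \<and>
     (\<forall>p\<in>fst Pr. \<exists>q\<in>fst Qs. q \<noteq> p \<and> d p q \<le> snd Pr) \<and>
     (\<forall>q\<in>fst Qs. \<exists>p\<in>fst Pr. mcball q (snd Qs) \<subseteq> mcball p (snd Pr)) \<and>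
     (\<forall>q\<in>fst Qs - fst Pr. disjnt (mcball q (snd Qs)) (F n))" for n and Pr Qs :: "'a set \<times> real"
  have ex: "\<exists>Qs. ok Qs \<and> step n Pr Qs" if ok: "ok Pr" for n Pr
  proof -
    obtain P r where Pr: "Pr = (P, r)" by fastforce
    have P: "finite P" "P \<subseteq> Y" "P \<noteq> {}" "0 < r" using ok by (auto simp: ok_def Pr)
    have "\<forall>p\<in>P. \<exists>q. q \<in> Y \<and> d p q < r / 2 \<and> q \<notin> F n \<and> q \<noteq> p"
      using nd' P(2,4) by (metis half_gt_zero subsetD)
    then obtain f where f: "\<And>p. p \<in> P \<Longrightarrow> f p \<in> Y \<and> d p (f p) < r / 2 \<and> f p \<notin> F n \<and> f p \<noteq> p"
      by metis
    define Q where "Q = P \<union> f ` P"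
    have Q: "finite Q" "Q \<subseteq> Y" "Q \<noteq> {}" "Q \<subseteq> M" using P f Y by (auto simp: Q_def)
    obtain s1 where s1: "0 < s1" "\<And>p q. p \<in> Q \<Longrightarrow> q \<in> Q \<Longrightarrow> p \<noteq> q \<Longrightarrow> s1 \<le> d p q"
      using finite_separated Q by metis
    have "\<forall>p\<in>P. \<exists>e>0. disjnt (mball (f p) e) (F n)"
    proof
      fix p assume "p \<in> P"
      then have "f p \<in> M - F n" using f Y by blast
      then show "\<exists>e>0. disjnt (mball (f p) e) (F n)"
        using F(1)[of n] unfolding closedin_metric by (metis disjnt_sym)
    qed
    then obtain e where e: "\<And>p. p \<in> P \<Longrightarrow> e p > 0 \<and> disjnt (mball (f p) (e p)) (F n)" by metis
    \<comment> \<open>The bound \<open>r / 2\<close> halves the radius and nests the balls,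
      \<open>s1 / 3\<close> makes the balls around distinct points of \<open>Q\<close> disjoint, and
      \<open>e p / 2\<close> keeps the closed ball around \<open>f p\<close> inside an open ball
      that misses \<open>F n\<close>.\<close>
    define s where "s = Min ({r / 2, s1 / 3} \<union> (\<lambda>p. e p / 2) ` P)"
    have "s \<le> x" if "x \<in> {r / 2, s1 / 3} \<union> (\<lambda>p. e p / 2) ` P" for x
      unfolding s_def using P(1) that by (intro Min_le) auto
    then have s_le: "s \<le> r / 2" "s \<le> s1 / 3" "\<And>p. p \<in> P \<Longrightarrow> s \<le> e p / 2" by blast+
    have s_pos: "0 < s" unfolding s_def using P s1(1) e by (subst Min_gr_iff) auto
    have "ok (Q, s)"
      unfolding ok_def fst_conv snd_conv
    proof (intro conjI ballI impI)
      fix p q assume pq: "p \<in> Q" "q \<in> Q" "p \<noteq> q"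
      show "disjnt (mcball p s) (mcball q s)"
        unfolding disjnt_iff
      proof (intro allI notI)
        fix x assume "x \<in> mcball p s \<and> x \<in> mcball q s"
        then have "d p q \<le> s + s" using triangle[of p x q] commute[of q x] by auto
        then show False using s1(2)[OF pq] s_le(2) s1(1) by auto
      qed
    qed (use Q s_pos in auto)
    moreover have "step n (P, r) (Q, s)"
      unfolding step_def fst_conv snd_conv
    proof (intro conjI ballI)
      fix p assume p: "p \<in> P"
      then show "\<exists>q\<in>Q. q \<noteq> p \<and> d p q \<le> r" using f[OF p] P(4) by (intro bexI[of _ "f p"]) (auto simp: Q_def)
    next
      fix q assume "q \<in> Q"
      then obtain p where p: "p \<in> P" "d p q \<le> r / 2"
        using f P Y by (fastforce simp: Q_def)
      have "mcball q s \<subseteq> mcball p r"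
      proof
        fix x assume x: "x \<in> mcball q s"
        have "p \<in> M" using p P Y by blast
        then show "x \<in> mcball p r" using x triangle[of p q x] p(2) s_le(1) by auto
      qed
      then show "\<exists>p\<in>P. mcball q s \<subseteq> mcball p r" using p(1) by blast
    next
      fix q assume "q \<in> Q - P"
      then obtain p where p: "p \<in> P" "q = f p" by (auto simp: Q_def)
      have "mcball q s \<subseteq> mball (f p) (e p)" using s_le(3)[OF p(1)] e[OF p(1)] p(2) by auto
      then show "disjnt (mcball q s) (F n)" using e[OF p(1)] unfolding disjnt_iff by blast
    qed (use s_le in \<open>auto simp: Q_def\<close>)
    ultimately show ?thesis unfolding Pr by blast
  qed
  obtain y0 where "y0 \<in> Y" using Y by blast
  then have "ok ({y0}, 1)" by (simp add: ok_def)
  then obtain Pr where Pr: "\<And>n. ok (Pr n)" "\<And>n. step n (Pr n) (Pr (Suc n))"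
    using dependent_nat_choice[of "\<lambda>_. ok" step] ex by metis
  define P where "P n = fst (Pr n)" for n
  define r where "r n = snd (Pr n)" for n
  have "finite (P n) \<and> P n \<subseteq> Y \<and> P n \<noteq> {} \<and> 0 < r n" for n
    using Pr(1)[of n] by (simp add: ok_def P_def r_def)
  then have P: "finite (P n)" "P n \<subseteq> Y" "P n \<noteq> {}" "0 < r n" for n by auto
  have P_disj: "p = q" if "p \<in> P n" "q \<in> P n" "x \<in> mcball p (r n)" "x \<in> mcball q (r n)" for n p q x
    using Pr(1)[of n] that unfolding ok_def P_def r_def disjnt_iff by blast
  have step: "step n (P n, r n) (P (Suc n), r (Suc n))" for n
    using Pr(2)[of n] by (simp add: P_def r_def)
  have S: "P n \<subseteq> P (Suc n)" "r (Suc n) \<le> r n / 2"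
    "\<And>p. p \<in> P n \<Longrightarrow> \<exists>q\<in>P (Suc n). q \<noteq> p \<and> d p q \<le> r n"
    "\<And>q. q \<in> P (Suc n) \<Longrightarrow> \<exists>p\<in>P n. mcball q (r (Suc n)) \<subseteq> mcball p (r n)"
    "\<And>q. q \<in> P (Suc n) - P n \<Longrightarrow> disjnt (mcball q (r (Suc n))) (F n)" for n
    using step[of n] unfolding step_def fst_conv snd_conv by auto
  have Pmono: "P m \<subseteq> P n" if "m \<le> n" for m n using S(1) that by (rule lift_Suc_mono_le)
  have rdec: "r n \<le> r m" if "m \<le> n" for m n
  proof (rule lift_Suc_antimono_le[OF _ that])
    show "r (Suc k) \<le> r k" for k using S(2)[of k] P(4)[of k] by linarith
  qed
  have r_le: "r n \<le> r 0 * (1/2) ^ n" for n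
  proof (induction n)
    case (Suc n) then show ?case using S(2)[of n] by simp
  qed simp
  have r_small: "\<exists>n\<ge>m. r n < e" if "e > 0" for m e
  proof -
    have "(\<lambda>n. r 0 * (1/2) ^ n) \<longlonglongrightarrow> 0" by (intro tendsto_mult_right_zero LIMSEQ_power_zero) simp
    then have "\<forall>\<^sub>F n in sequentially. r 0 * (1/2) ^ n < e" using that by (rule order_tendstoD(2))
    then obtain N where "\<And>n. n \<ge> N \<Longrightarrow> r 0 * (1/2) ^ n < e" by (auto simp: eventually_sequentially)
    then show ?thesis using r_le by (meson le_less_trans max.cobounded1 max.cobounded2)
  qed
  \<comment> \<open>The sets \<open>K n\<close> are closed and decreasing and contain
    \<open>P n\<close>, hence all of \<open>D\<close>. So each of them contains the closure of
    \<open>D\<close>.\<close>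
  define K where "K n = (\<Union>p\<in>P n. mcball p (r n))" for n
  have Kcl: "closedin mtopology (K n)" for n
    unfolding K_def using P(1) by (intro closedin_Union) auto
  have Kdec: "K n \<subseteq> K m" if "m \<le> n" for m n
    using S(4) by (intro lift_Suc_antimono_le[OF _ that]) (fastforce simp: K_def)
  define D where "D = (\<Union>n. P n)"
  have DY: "D \<subseteq> Y" using P(2) by (auto simp: D_def)
  have DM: "D \<subseteq> M" using DY Y by blast
  have PK: "P n \<subseteq> K n" for n using P(2)[of n] P(4)[of n] Y by (force simp: K_def)
  have DK: "D \<subseteq> K n" for n
  proof
    fix x assume "x \<in> D"
    then obtain m where m: "x \<in> P m" by (auto simp: D_def)
    then have "x \<in> P (max m n)" using Pmono[of m "max m n"] by auto
    then show "x \<in> K n" using PK Kdec[of n "max m n"] by auto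
  qed
  have "mtopology closure_of D \<subseteq> D"
  proof
    fix y assume y: "y \<in> mtopology closure_of D"
    have yK: "y \<in> K n" for n using y closure_of_minimal[OF DK Kcl] by blast
    have "y \<in> Y" using y closure_of_minimal[OF DY clY] by blast
    then obtain m where m: "y \<in> F m" using cov by blast
    obtain p where p: "p \<in> P m" "y \<in> mcball p (r m)" using yK[of m] by (auto simp: K_def)
    have "y \<in> mcball p (r n)" if "m \<le> n" for n
      using that
    proof (induction n rule: dec_induct)
      case base then show ?case by (rule p)
    next
      case (step n)
      obtain q where q: "q \<in> P (Suc n)" "y \<in> mcball q (r (Suc n))" using yK[of "Suc n"] by (auto simp: K_def)
      \<comment> \<open>The balls around points added at this step avoid \<open>F n\<close>, so
        \<open>q\<close> is an old point. Disjointness of the balls of stage \<open>n\<close> then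
        identifies it with \<open>p\<close>.\<close>
      have "y \<in> F n" using m F(2) step(1) by (auto simp: incseq_def)
      then have "q \<in> P n" using S(5)[of q n] q by (auto simp: disjnt_iff)
      moreover have "y \<in> mcball q (r n)" using q(2) rdec[of n "Suc n"] by auto
      ultimately have "p = q" using P_disj[of p n q y] step Pmono[OF step(1)] p(1) by blast
      then show ?case using q by simp
    qed
    then have "d p y \<le> r n" if "m \<le> n" for n using that by simp
    then have "d p y < e" if "0 < e" for e using r_small[OF that, of m] by force
    then have "d p y \<le> 0" by (meson less_irrefl not_le)
    then have "p = y" using p(2) nonneg[of p y] by simp
    then show "y \<in> D" using p(1) by (auto simp: D_def)
  qed
  then have clD: "closedin mtopology D"
    using DM by (metis closure_of_subset closure_of_eq subset_antisym topspace_mtopology)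
  show thesis
  proof
    show "D \<subseteq> Y" by (fact DY)
    show "D \<noteq> {}" using P(3) by (auto simp: D_def)
    show "countable D" unfolding D_def using P(1) by (auto intro: countable_finite)
    show "closedin mtopology D" by (fact clD)
    show "\<exists>y\<in>D. y \<noteq> x \<and> d x y < e" if x: "x \<in> D" "0 < e" for x e
    proof -
      obtain m where m: "x \<in> P m" using x(1) by (auto simp: D_def)
      obtain n where n: "n \<ge> m" "r n < e" using r_small x(2) by blast
      then have "x \<in> P n" using m Pmono by blast
      then obtain q where "q \<in> P (Suc n)" "q \<noteq> x" "d x q \<le> r n" using S(3) by blast
      then show ?thesis using n(2) by (intro bexI[of _ q]) (auto simp: D_def)
    qed
  qed
qed

section \<open>Resolvable sets\<close>

text \<open>The points of \<open>A i\<close> at distance at least \<open>1/n\<close> from \<open>B i\<close> form, for varying \<open>i\<close>, a family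
  of closed sets that are pairwise \<open>1/n\<close> apart, so their union is closed even if \<open>I\<close> is uncountable.\<close>

lemma (in Metric_space) fsigma_in_Union_Diff:
  assumes A: "\<And>i. i \<in> I \<Longrightarrow> closedin mtopology (A i)" and B: "\<And>i. i \<in> I \<Longrightarrow> closedin mtopology (B i)"
    and AB: "\<And>i j. i \<in> I \<Longrightarrow> j \<in> I \<Longrightarrow> i \<noteq> j \<Longrightarrow> A i \<subseteq> B j \<or> A j \<subseteq> B i"
  shows "fsigma_in mtopology (\<Union>i\<in>I. A i - B i)"
proof -
  define \<epsilon> where "\<epsilon> n = 1 / real (Suc n)" for n
  have \<epsilon>: "0 < \<epsilon> n" for n by (simp add: \<epsilon>_def)
  define T where "T n i = A i \<inter> (M - (\<Union>y\<in>B i. mball y (\<epsilon> n)))" for n i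
  have Tcl: "closedin mtopology (T n i)" if "i \<in> I" for n i
    unfolding T_def using that A by (intro closedin_Int) (auto intro!: openin_closedin_eq[THEN iffD1, THEN conjunct2] closedin_diff)
  have T_iff: "x \<in> T n i \<longleftrightarrow> x \<in> A i \<and> (\<forall>y\<in>B i. \<epsilon> n \<le> d y x)" if "i \<in> I" for x n i
    using closedin_subset[OF A[OF that]] closedin_subset[OF B[OF that]] by (fastforce simp: T_def)
  have sep: "i = j" if "i \<in> I" "j \<in> I" "x \<in> T n i" "y \<in> T n j" "d x y < \<epsilon> n" for i j x y n
  proof (rule ccontr)
    assume "i \<noteq> j"
    \<comment> \<open>One of the two points lies in the set from which the other keeps distance at
      least \<open>\<epsilon> n\<close>.\<close>
    then have "x \<in> B j \<or> y \<in> B i" using AB[OF that(1,2)] that(3,4) by (auto simp: T_def)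
    then show False using that T_iff commute by fastforce
  qed
  have cl: "closedin mtopology (\<Union>i\<in>I. T n i)" for n
    unfolding closedin_metric
  proof (intro conjI allI impI)
    show "(\<Union>i\<in>I. T n i) \<subseteq> M" by (auto simp: T_def)
    fix x assume x: "x \<in> M - (\<Union>i\<in>I. T n i)"
    show "\<exists>r>0. disjnt (\<Union>i\<in>I. T n i) (mball x r)"
    proof (cases "\<exists>i\<in>I. \<not> disjnt (T n i) (mball x (\<epsilon> n / 2))")
      case False
      then show ?thesis using \<epsilon>[of n] by (intro exI[of _ "\<epsilon> n / 2"]) auto
    next
      case True
      \<comment> \<open>By \<open>sep\<close>, a ball of radius \<open>\<epsilon> n / 2\<close>
        meets at most one of the sets \<open>T n i\<close>, so near \<open>x\<close> the union is a
        single closed set.\<close>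
      then obtain i y where i: "i \<in> I" "y \<in> T n i" "d x y < \<epsilon> n / 2" "y \<in> M" unfolding disjnt_iff by auto
      obtain r where r: "0 < r" "disjnt (T n i) (mball x r)"
        using Tcl[OF i(1), of n] x i(1) unfolding closedin_metric by blast
      have "disjnt (\<Union>i\<in>I. T n i) (mball x (min r (\<epsilon> n / 2)))"
        unfolding disjnt_iff
      proof (intro allI notI)
        fix z assume z: "z \<in> (\<Union>i\<in>I. T n i) \<and> z \<in> mball x (min r (\<epsilon> n / 2))"
        then obtain j where j: "j \<in> I" "z \<in> T n j" by blast
        have "d z y < \<epsilon> n" using z i x triangle[of z x y] commute[of z x] by auto
        then have "j = i" using sep i j by blast
        then show False using r(2) j z by (auto simp: disjnt_iff)
      qed
      then show ?thesis using r(1) \<epsilon>[of n] by (intro exI[of _ "min r (\<epsilon> n / 2)"]) auto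
    qed
  qed
  have "(\<Union>i\<in>I. A i - B i) = (\<Union>n. \<Union>i\<in>I. T n i)"
  proof (intro equalityI subsetI)
    fix x assume "x \<in> (\<Union>i\<in>I. A i - B i)"
    then obtain i where i: "i \<in> I" "x \<in> A i" "x \<notin> B i" by blast
    then have "x \<in> M - B i" using closedin_subset[OF A] by auto
    then obtain r where r: "0 < r" "disjnt (B i) (mball x r)"
      using B[OF i(1)] unfolding closedin_metric by blast
    obtain n where n: "\<epsilon> n < r" unfolding \<epsilon>_def using r(1) nat_approx_posE by blast
    have "\<epsilon> n \<le> d y x" if "y \<in> B i" for y
      using that r(2) closedin_subset[OF B[OF i(1)]] n \<open>x \<in> M - B i\<close> commute[of y x] by (fastforce simp: disjnt_iff)
    then have "x \<in> T n i" using i T_iff[OF i(1)] by simp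
    then show "x \<in> (\<Union>n. \<Union>i\<in>I. T n i)" using i(1) by blast
  next
    fix x assume "x \<in> (\<Union>n. \<Union>i\<in>I. T n i)"
    then obtain n i where i: "i \<in> I" "x \<in> T n i" by blast
    then have "x \<in> A i" "\<forall>y\<in>B i. \<epsilon> n \<le> d y x" "x \<in> M" using T_iff[OF i(1)] closedin_subset[OF A[OF i(1)]] by auto
    then have "x \<notin> B i" using \<epsilon>[of n] by force
    then show "x \<in> (\<Union>i\<in>I. A i - B i)" using i \<open>x \<in> A i\<close> by blast
  qed
  moreover have "fsigma_in mtopology (\<Union>(range (\<lambda>n. \<Union>i\<in>I. T n i)))"
    by (rule fsigma_in_Union) (use cl closed_imp_fsigma_in in blast)+
  ultimately show ?thesis by simp
qed

section \<open>Layers of a resolution\<close>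

definition residual :: "'a topology \<Rightarrow> 'i rel \<Rightarrow> ('i \<Rightarrow> 'a set) \<Rightarrow> 'i \<Rightarrow> 'a set" where
  "residual X r F \<xi> = {x \<in> topspace X. \<forall>\<eta>\<in>underS r \<xi>. x \<in> F \<eta>}"

text \<open>A layer is indexed by the set that is removed. In a difference that contributes to the
  resolved set, this is the successor of an even index.\<close>

definition even_sucs :: "'i rel \<Rightarrow> 'i set" where
  "even_sucs r = {\<eta>. \<exists>\<xi>. even_ord r \<xi> \<and> is_suc r \<xi> \<eta>}"

lemma even_sucs_subset: "even_sucs r \<subseteq> Field r"
  by (auto simp: even_sucs_def is_suc_def)

lemma Well_order_least:
  assumes "Well_order r" "\<xi>\<^sub>0 \<in> Field r" "P \<xi>\<^sub>0"
  obtains \<xi> where "\<xi> \<in> Field r" "P \<xi>" "\<And>\<eta>. \<eta> \<in> underS r \<xi> \<Longrightarrow> \<not> P \<eta>"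
proof -
  have wf: "wf (r - Id)" using assms(1) by (simp add: well_order_on_def)
  have Q: "\<xi>\<^sub>0 \<in> {\<xi> \<in> Field r. P \<xi>}" using assms by simp
  show thesis
  proof (rule wfE_min[OF wf Q])
    fix \<xi> assume "\<xi> \<in> {\<xi> \<in> Field r. P \<xi>}"
      and "\<And>\<eta>. (\<eta>, \<xi>) \<in> r - Id \<Longrightarrow> \<eta> \<notin> {\<xi> \<in> Field r. P \<xi>}"
    then show thesis by (intro that[of \<xi>]) (auto simp: underS_def FieldI1)
  qed
qed

text \<open>A point outside some \<open>F \<xi>\<close> lies in exactly one layer
  \<open>residual X r F \<xi> - F \<xi>\<close>, that of the least such index. At the successor of
  an index the residual is the preceding set \<open>F\<close>, so the layers in
  \<open>even_sucs\<close> are the differences that make up \<open>E\<close>. The remaining layers,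
  which include those at zero and at limits, fill the complement together with the points that lie
  in every \<open>F \<xi>\<close>.\<close>

lemma resolution_residual:
  assumes "resolution X r F E"
  shows closedin_residual: "closedin X (residual X r F \<xi>)"
    and residual_subset: "\<lbrakk>\<xi> \<in> Field r; \<eta> \<in> Field r; \<xi> \<noteq> \<eta>\<rbrakk>
       \<Longrightarrow> residual X r F \<xi> \<subseteq> F \<eta> \<or> residual X r F \<eta> \<subseteq> F \<xi>"
    and resolution_eq: "E = (\<Union>\<xi>\<in>even_sucs r. residual X r F \<xi> - F \<xi>)"
    and resolution_compl_eq: "topspace X - E =
       (\<Union>\<xi>\<in>Field r - even_sucs r. residual X r F \<xi> - F \<xi>) \<union> {x \<in> topspace X. \<forall>\<xi>\<in>Field r. x \<in> F \<xi>}"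
proof -
  have wo: "Well_order r" and clo: "\<And>\<xi>. \<xi> \<in> Field r \<Longrightarrow> closedin X (F \<xi>)"
    and dec: "\<And>\<xi> \<eta>. (\<xi>, \<eta>) \<in> r \<Longrightarrow> F \<eta> \<subseteq> F \<xi>"
    and E: "E = \<Union>{F \<xi> - F \<eta> | \<xi> \<eta>. even_ord r \<xi> \<and> is_suc r \<xi> \<eta>}"
    using assms by (auto simp: resolution_def)
  have tot: "\<eta> \<in> underS r \<xi> \<or> \<xi> \<in> underS r \<eta>" if "\<xi> \<in> Field r" "\<eta> \<in> Field r" "\<xi> \<noteq> \<eta>" for \<xi> \<eta>
    using wo that unfolding order_on_defs total_on_def underS_def by blast
  let ?A = "residual X r F" and ?S = "even_sucs r"
  have "?A \<xi> = topspace X \<inter> (\<Inter>\<eta>\<in>underS r \<xi>. F \<eta>)" by (auto simp: residual_def)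
  moreover have "closedin X (F \<eta>)" if "\<eta> \<in> underS r \<xi>" for \<eta>
    using that clo by (auto simp: underS_def FieldI1)
  ultimately show "closedin X (?A \<xi>)"
    by (cases "underS r \<xi> = {}") (auto intro!: closedin_Int closedin_Inter)
  show AF: "?A \<xi> \<subseteq> F \<eta> \<or> ?A \<eta> \<subseteq> F \<xi>" if "\<xi> \<in> Field r" "\<eta> \<in> Field r" "\<xi> \<noteq> \<eta>" for \<xi> \<eta>
    using tot[OF that] by (auto simp: residual_def)
  have suc: "\<xi> \<in> underS r \<eta>" "?A \<eta> \<inter> F \<xi> = F \<xi>" if "is_suc r \<xi> \<eta>" for \<xi> \<eta>
  proof -
    have *: "\<xi> \<in> Field r" "underS r \<eta> = under r \<xi>" using that by (auto simp: is_suc_def)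
    then show "\<xi> \<in> underS r \<eta>" using wo by (auto simp: under_def order_on_defs refl_on_def)
    show "?A \<eta> \<inter> F \<xi> = F \<xi>"
      using * clo[OF *(1), THEN closedin_subset] dec by (fastforce simp: residual_def under_def)
  qed
  show EA: "E = (\<Union>\<xi>\<in>?S. ?A \<xi> - F \<xi>)"
  proof (intro equalityI subsetI)
    fix x assume "x \<in> E"
    then obtain \<xi> \<eta> where "even_ord r \<xi>" "is_suc r \<xi> \<eta>" "x \<in> F \<xi> - F \<eta>" unfolding E by blast
    then show "x \<in> (\<Union>\<xi>\<in>?S. ?A \<xi> - F \<xi>)" using suc(2)[of \<xi> \<eta>] by (auto simp: even_sucs_def)
  next
    fix x assume "x \<in> (\<Union>\<xi>\<in>?S. ?A \<xi> - F \<xi>)"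
    then obtain \<xi> \<eta> where "even_ord r \<xi>" "is_suc r \<xi> \<eta>" "x \<in> ?A \<eta> - F \<eta>" unfolding even_sucs_def by blast
    then show "x \<in> E" unfolding E using suc(1)[of \<xi> \<eta>] by (auto simp: residual_def)
  qed
  show cE: "topspace X - E = (\<Union>\<xi>\<in>Field r - ?S. ?A \<xi> - F \<xi>) \<union> {x \<in> topspace X. \<forall>\<xi>\<in>Field r. x \<in> F \<xi>}"
  proof (intro equalityI subsetI)
    fix x assume x: "x \<in> topspace X - E"
    show "x \<in> (\<Union>\<xi>\<in>Field r - ?S. ?A \<xi> - F \<xi>) \<union> {x \<in> topspace X. \<forall>\<xi>\<in>Field r. x \<in> F \<xi>}"
    proof (cases "\<forall>\<xi>\<in>Field r. x \<in> F \<xi>")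
      case False
      then obtain \<xi> where \<xi>: "\<xi> \<in> Field r" "x \<notin> F \<xi>"
        and min: "\<And>\<eta>. \<eta> \<in> underS r \<xi> \<Longrightarrow> \<not> x \<notin> F \<eta>"
        using Well_order_least[OF wo, where P = "\<lambda>\<xi>. x \<notin> F \<xi>"] by metis
      have "x \<in> ?A \<xi>" using min x by (auto simp: residual_def)
      then show ?thesis using \<xi> x EA by blast
    qed (use x in auto)
  next
    fix x assume x: "x \<in> (\<Union>\<xi>\<in>Field r - ?S. ?A \<xi> - F \<xi>) \<union> {x \<in> topspace X. \<forall>\<xi>\<in>Field r. x \<in> F \<xi>}"
    then show "x \<in> topspace X - E"
    proof
      assume "x \<in> (\<Union>\<xi>\<in>Field r - ?S. ?A \<xi> - F \<xi>)"
      then obtain \<xi> where \<xi>: "\<xi> \<in> Field r" "\<xi> \<notin> ?S" "x \<in> ?A \<xi> - F \<xi>" by blast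
      have "x \<notin> ?A \<eta> - F \<eta>" if "\<eta> \<in> ?S" for \<eta> using AF[of \<xi> \<eta>] that even_sucs_subset[of r] \<xi> by blast
      then show ?thesis using \<xi> EA by (auto simp: residual_def)
    qed (use EA even_sucs_subset[of r] in auto)
  qed
qed

text \<open>\<open>E\<close> is a union of layers, and its complement is a union of layers and a
  closed set. Distinct layers are related as \<open>fsigma_in_Union_Diff\<close> demands, so both
  sets are F-sigma.\<close>

lemma resolvable_in_imp_delta02_in:
  assumes "metrizable_space X" "resolvable_in X E"
  shows "delta02_in X E"
proof -
  obtain M d where "Metric_space M d" and X: "X = Metric_space.mtopology M d"
    using assms(1) by (auto simp: metrizable_space_def)
  interpret Metric_space M d by fact
  obtain r :: "('a \<times> bool) rel" and F where res: "resolution X r F E"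
    using assms(2) by (auto simp: resolvable_in_def)
  define A where "A = residual X r F"
  define S where "S = even_sucs r"
  note S = even_sucs_subset[of r, folded S_def]
  note AF = residual_subset[OF res, folded A_def] and A = closedin_residual[OF res, folded A_def]
    and E = resolution_eq[OF res, folded A_def S_def]
    and cE = resolution_compl_eq[OF res, folded A_def S_def]
  have F: "\<And>\<xi>. \<xi> \<in> Field r \<Longrightarrow> closedin X (F \<xi>)" using res by (auto simp: resolution_def)
  have fs: "fsigma_in X (\<Union>\<xi>\<in>T. A \<xi> - F \<xi>)" if "T \<subseteq> Field r" for T
    unfolding X
  proof (rule fsigma_in_Union_Diff)
    show "closedin mtopology (A \<xi>)" for \<xi> using A by (simp add: X)
    show "closedin mtopology (F \<xi>)" if "\<xi> \<in> T" for \<xi> using F[of \<xi>] that \<open>T \<subseteq> Field r\<close> unfolding X by blast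
    show "A \<xi> \<subseteq> F \<eta> \<or> A \<eta> \<subseteq> F \<xi>" if "\<xi> \<in> T" "\<eta> \<in> T" "\<xi> \<noteq> \<eta>" for \<xi> \<eta>
      using AF that \<open>T \<subseteq> Field r\<close> by (meson subsetD)
  qed
  have "{x \<in> topspace X. \<forall>\<xi>\<in>Field r. x \<in> F \<xi>} = topspace X \<inter> (\<Inter>\<xi>\<in>Field r. F \<xi>)" by auto
  then have "closedin X {x \<in> topspace X. \<forall>\<xi>\<in>Field r. x \<in> F \<xi>}"
    using F by (cases "Field r = {}") (auto intro!: closedin_Int closedin_Inter)
  then have "fsigma_in X (topspace X - E)"
    unfolding cE using fs[of "Field r - S"] by (intro fsigma_in_Un) (auto intro: closed_imp_fsigma_in)
  moreover have "fsigma_in X E" using fs[OF S] E by simp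
  ultimately show ?thesis
    using fsigma_in_subset by (auto simp: delta02_in_def gdelta_in_fsigma_in)
qed

text \<open>At the first index with \<open>C\<close> not inside \<open>F \<xi>\<close>, the set
  \<open>C\<close> lies in the residual, so its part outside \<open>F \<xi>\<close> lies in a single
  layer, and a layer is either inside \<open>E\<close> or disjoint from it. Without such an index
  \<open>C\<close> misses \<open>E\<close>.\<close>

lemma resolvable_in_homogeneous_part:
  assumes "resolvable_in X E" and C: "C \<subseteq> topspace X" "C \<noteq> {}"
  obtains U where "openin X U" "U \<inter> C \<noteq> {}" "U \<inter> C \<subseteq> E \<or> U \<inter> C \<inter> E = {}"
proof -
  obtain r :: "('a \<times> bool) rel" and F where res: "resolution X r F E"
    using assms(1) by (auto simp: resolvable_in_def)
  have wo: "Well_order r" and clF: "\<And>\<xi>. \<xi> \<in> Field r \<Longrightarrow> closedin X (F \<xi>)"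
    using res by (auto simp: resolution_def)
  define A where "A = residual X r F"
  define S where "S = even_sucs r"
  note A_eq = residual_def[of X r F, folded A_def]
    and E = resolution_eq[OF res, folded A_def S_def]
    and cE = resolution_compl_eq[OF res, folded A_def S_def]
  show thesis
  proof (cases "\<forall>\<xi>\<in>Field r. C \<subseteq> F \<xi>")
    case True
    then have "C \<subseteq> topspace X - E" unfolding cE using C by blast
    then show ?thesis using that[of "topspace X"] C by blast
  next
    case False
    then obtain \<xi> where \<xi>: "\<xi> \<in> Field r" "\<not> C \<subseteq> F \<xi>"
      and min: "\<And>\<eta>. \<eta> \<in> underS r \<xi> \<Longrightarrow> \<not> \<not> C \<subseteq> F \<eta>"
      using Well_order_least[OF wo, where P = "\<lambda>\<xi>. \<not> C \<subseteq> F \<xi>"] by metis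
    have "C \<subseteq> A \<xi>" using min C(1) by (auto simp: A_eq)
    then have "(topspace X - F \<xi>) \<inter> C \<subseteq> A \<xi> - F \<xi>" by blast
    moreover have "A \<xi> - F \<xi> \<subseteq> E \<or> A \<xi> - F \<xi> \<subseteq> topspace X - E"
      using \<xi>(1) cE E by blast
    ultimately show ?thesis
      using that[of "topspace X - F \<xi>"] clF[OF \<xi>(1)] \<xi>(2) C(1) by blast
  qed
qed

section \<open>Construction of resolutions\<close>

lemma resolvable_in_Union_Diff:
  fixes X :: "'a topology" and r :: "'i rel"
  assumes wo: "Well_order r" and S: "S \<subseteq> Field r"
    and A: "\<And>i. i \<in> S \<Longrightarrow> closedin X (A i)" and B: "\<And>i. i \<in> S \<Longrightarrow> closedin X (B i)"
    and BA: "\<And>i. i \<in> S \<Longrightarrow> B i \<subseteq> A i"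
    and AB: "\<And>i j. i \<in> S \<Longrightarrow> j \<in> S \<Longrightarrow> (i, j) \<in> r \<Longrightarrow> i \<noteq> j \<Longrightarrow> A j \<subseteq> B i"
  shows "resolvable_in X (\<Union>i\<in>S. A i - B i)"
proof -
  have refl: "\<And>i. i \<in> S \<Longrightarrow> (i, i) \<in> r" and tr: "trans r" and anti: "antisym r"
    using wo S by (auto simp: order_on_defs refl_on_def)
  have tot: "(i, j) \<in> r \<or> (j, i) \<in> r" if "i \<in> S" "j \<in> S" for i j
    using wo refl S that unfolding order_on_defs total_on_def by (metis subsetD)
  have wf: "wf (r - Id)" using wo by (simp add: well_order_on_def)
  \<comment> \<open>Each index in \<open>S\<close> is doubled: \<open>(i, False)\<close> will carry
    \<open>A i\<close> and its immediate successor \<open>(i, True)\<close> will carry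
    \<open>B i\<close>.\<close>
  define s :: "('i \<times> bool) rel" where
    "s = {((i, a), (j, b)) | i j a b. i \<in> S \<and> j \<in> S \<and> (i, j) \<in> r \<and> (i = j \<longrightarrow> a \<le> b)}"
  have s_iff: "((i, a), (j, b)) \<in> s \<longleftrightarrow> i \<in> S \<and> j \<in> S \<and> (i, j) \<in> r \<and> (i = j \<longrightarrow> a \<le> b)" for i j a b
    by (auto simp: s_def)
  have FS: "Field s = S \<times> UNIV"
  proof (intro equalityI subsetI)
    fix z assume "z \<in> S \<times> (UNIV :: bool set)"
    then have "(z, z) \<in> s" using refl by (cases z) (auto simp: s_iff)
    then show "z \<in> Field s" by (rule FieldI1)
  qed (auto simp: s_def Field_def)
  have wos: "Well_order s"
    unfolding well_order_on_def linear_order_on_def partial_order_on_def preorder_on_def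
  proof (intro conjI)
    show "refl_on (Field s) s" using refl by (auto simp: refl_on_def FS s_iff)
    show "s \<subseteq> Field s \<times> Field s" by (auto simp: FieldI1 FieldI2)
    show "trans s"
    proof (rule transI)
      fix x y z assume *: "(x, y) \<in> s" "(y, z) \<in> s"
      obtain i a j b k c where z: "x = (i, a)" "y = (j, b)" "z = (k, c)" by (metis surj_pair)
      have "(i, k) \<in> r" using * transD[OF tr, of i j k] by (auto simp: z s_iff)
      moreover have "a \<le> c" if "i = k"
      proof -
        have "i = j" using * antisymD[OF anti, of i j] that by (auto simp: z s_iff)
        then show ?thesis using * that by (auto simp: z s_iff)
      qed
      ultimately show "(x, z) \<in> s" using * by (auto simp: z s_iff)
    qed
    show "antisym s"
    proof (rule antisymI)
      fix x y assume *: "(x, y) \<in> s" "(y, x) \<in> s"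
      obtain i a j b where z: "x = (i, a)" "y = (j, b)" by fastforce
      then have "i = j" using * antisymD[OF anti] by (auto simp: s_iff)
      then show "x = y" using * z by (auto simp: s_iff)
    qed
    show "total_on (Field s) s" unfolding total_on_def FS using tot by (auto simp: s_iff)
    have "s - Id \<subseteq> (r - Id) <*lex*> {(False, True)}" by (auto simp: s_def)
    moreover have "wf {(False, True)}" by (intro wf_insert[THEN iffD2]) auto
    ultimately show "wf (s - Id)" using wf_subset wf_lex_prod[OF wf] by metis
  qed
  have suc_s: "is_suc s (i, False) (i, True)" if "i \<in> S" for i
    unfolding is_suc_iff[OF wos] using that refl by (auto simp: s_iff)
  have suc_False: "\<exists>j\<in>S. y = (j, True) \<and> (j, i) \<in> r - Id" if y: "is_suc s y (i, False)" for i y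
  proof -
    obtain j a where j: "y = (j, a)" by fastforce
    have 1: "j \<in> S" "(j, i) \<in> r" "j \<noteq> i" using y unfolding is_suc_iff[OF wos] j s_iff by auto
    have "a"
    proof (rule ccontr)
      assume "\<not> a"
      then have "(i, False) = (j, True)" using y suc_s[OF 1(1)] suc_unique[OF wos] j by metis
      then show False by simp
    qed
    then show ?thesis using 1 j by auto
  qed
  \<comment> \<open>If \<open>(i, False)\<close> is a successor, then it follows some
    \<open>(j, True)\<close> and so comes two steps after \<open>(j, False)\<close>, which is even
    by induction. An even \<open>(i, True)\<close> would make such a \<open>(j, True)\<close> even,
    against the induction hypothesis.\<close>
  have even_s: "i \<in> S \<longrightarrow> even_ord s (i, False) \<and> \<not> even_ord s (i, True)" for i
  proof (rule wf_induct_rule[OF wf, of _ i], intro impI conjI)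
    fix i assume IH: "\<And>j. (j, i) \<in> r - Id \<Longrightarrow> j \<in> S \<longrightarrow> even_ord s (j, False) \<and> \<not> even_ord s (j, True)"
      and i: "i \<in> S"
    show "even_ord s (i, False)"
    proof (cases "\<exists>y. is_suc s y (i, False)")
      case False
      then show ?thesis using i by (auto intro!: zero_or_limit simp: FS)
    next
      case True
      then obtain j where "is_suc s (j, True) (i, False)" "j \<in> S" "(j, i) \<in> r - Id"
        using suc_False by blast
      then show ?thesis using IH suc_s plus_two by metis
    qed
    show "\<not> even_ord s (i, True)"
    proof
      assume "even_ord s (i, True)"
      then show False
      proof cases
        case zero_or_limit
        then show False using suc_s[OF i] by blast
      next
        case (plus_two a b)
        then have "b = (i, False)" using pred_unique[OF wos] suc_s[OF i] by blast
        then show False using suc_False plus_two IH by blast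
      qed
    qed
  qed
  have pairs: "(even_ord s x \<and> is_suc s x y) \<longleftrightarrow> (\<exists>i\<in>S. x = (i, False) \<and> y = (i, True))" for x y
  proof
    assume xy: "even_ord s x \<and> is_suc s x y"
    then obtain i a where i: "x = (i, a)" "i \<in> S" by (auto simp: is_suc_def FS)
    then have "\<not> a" using even_s xy by auto
    then have "y = (i, True)" using i xy suc_unique[OF wos _ suc_s[OF i(2)]] by simp
    then show "\<exists>i\<in>S. x = (i, False) \<and> y = (i, True)" using i \<open>\<not> a\<close> by auto
  qed (use even_s suc_s in auto)
  define F where "F = (\<lambda>(i, a). if a then B i else A i)"
  have "resolution X s F (\<Union>i\<in>S. A i - B i)"
    unfolding resolution_def pairs
  proof (intro conjI ballI allI impI)
    show "closedin X (F z)" if "z \<in> Field s" for z using that A B by (auto simp: FS F_def)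
    show "F y \<subseteq> F x" if xy: "(x, y) \<in> s" for x y
    proof -
      obtain i a j b where z: "x = (i, a)" "y = (j, b)" by fastforce
      have ij: "i \<in> S" "j \<in> S" "(i, j) \<in> r" "i = j \<longrightarrow> a \<le> b" using xy by (auto simp: z s_iff)
      show ?thesis
      proof (cases "i = j")
        case True then show ?thesis using ij BA[of i] by (cases a) (auto simp: F_def z)
      next
        case False then show ?thesis using ij BA[of i] BA[of j] AB[of i j] by (auto simp: F_def z)
      qed
    qed
    show "(\<Union>i\<in>S. A i - B i) = \<Union>{F x - F y |x y. \<exists>i\<in>S. x = (i, False) \<and> y = (i, True)}"
    proof -
      have "{F x - F y |x y. \<exists>i\<in>S. x = (i, False) \<and> y = (i, True)} = (\<lambda>i. A i - B i) ` S"
        by (simp add: F_def image_def) blast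
      then show ?thesis by simp
    qed
  qed (fact wos)
  then show ?thesis by (rule resolution_imp_resolvable_in)
qed

text \<open>The open sets \<open>W\<close> increase strictly until they exhaust the space; by Cantor's theorem a well-order
  of \<open>'a set\<close> is long enough for this.\<close>

lemma homogeneous_imp_resolvable_in:
  fixes X :: "'a topology"
  assumes E: "E \<subseteq> topspace X"
    and hom: "\<And>C. closedin X C \<Longrightarrow> C \<noteq> {} \<Longrightarrow>
      \<exists>U. openin X U \<and> U \<inter> C \<noteq> {} \<and> (U \<inter> C \<subseteq> E \<or> U \<inter> C \<inter> E = {})"
  shows "resolvable_in X E"
proof -
  \<comment> \<open>This is \<open>hom\<close> for the closed complement of \<open>V\<close>, in a
    form that yields a choice function \<open>u\<close>.\<close>
  have "\<forall>V. \<exists>U. openin X V \<and> V \<noteq> topspace X \<longrightarrow>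
      openin X U \<and> U - V \<noteq> {} \<and> (U - V \<subseteq> E \<or> (U - V) \<inter> E = {})"
  proof
    fix V
    show "\<exists>U. openin X V \<and> V \<noteq> topspace X \<longrightarrow>
      openin X U \<and> U - V \<noteq> {} \<and> (U - V \<subseteq> E \<or> (U - V) \<inter> E = {})"
    proof (cases "openin X V \<and> V \<noteq> topspace X")
      case True
      then have "closedin X (topspace X - V)" "topspace X - V \<noteq> {}" using openin_subset by blast+
      then obtain U where U: "openin X U" "U \<inter> (topspace X - V) \<noteq> {}"
        "U \<inter> (topspace X - V) \<subseteq> E \<or> U \<inter> (topspace X - V) \<inter> E = {}" using hom by meson
      have "U \<inter> (topspace X - V) = U - V" using openin_subset[OF U(1)] by blast
      then show ?thesis using U by auto
    qed blast
  qed
  then obtain u where u0: "\<And>V. openin X V \<and> V \<noteq> topspace X \<longrightarrow>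
      openin X (u V) \<and> u V - V \<noteq> {} \<and> (u V - V \<subseteq> E \<or> (u V - V) \<inter> E = {})" by metis
  have u: "openin X (u V)" "u V - V \<noteq> {}" "u V - V \<subseteq> E \<or> (u V - V) \<inter> E = {}"
    if "openin X V" "V \<noteq> topspace X" for V using that u0[of V] by simp_all
  obtain r :: "'a set rel" where wo: "Well_order r" and FU: "Field r = UNIV"
    by (meson well_ordering)
  have wf: "wf (r - Id)" using wo by (simp add: well_order_on_def)
  \<comment> \<open>The whole space is a fixed point, since \<open>u\<close> is specified only for
    the other open sets.\<close>
  define next_open where "next_open V = (if V = topspace X then V else V \<union> u V)" for V
  define W where "W = wfrec (r - Id) (\<lambda>f \<xi>. next_open (\<Union>(f ` underS r \<xi>)))"
  define V where "V \<xi> = \<Union>(W ` underS r \<xi>)" for \<xi>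
  have W: "W \<xi> = next_open (V \<xi>)" for \<xi>
  proof -
    have "cut W (r - Id) \<xi> ` underS r \<xi> = W ` underS r \<xi>"
      by (intro image_cong refl) (auto simp: cut_def underS_def)
    then show ?thesis using wfrec[OF wf, of "\<lambda>f \<xi>. next_open (\<Union>(f ` underS r \<xi>))" \<xi>]
      by (simp add: W_def V_def)
  qed
  have openW: "openin X (W \<xi>)" for \<xi>
  proof (induction \<xi> rule: wf_induct_rule[OF wf])
    case (1 \<xi>)
    then have "openin X (V \<xi>)" unfolding V_def by (intro openin_Union) (auto simp: underS_def)
    then show ?case using u(1) by (auto simp: W next_open_def)
  qed
  then have openV: "openin X (V \<xi>)" for \<xi> unfolding V_def by (intro openin_Union) auto
  have VW: "V \<xi> \<subseteq> W \<xi>" for \<xi> by (auto simp: W next_open_def)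
  have WV: "W \<eta> \<subseteq> V \<xi>" if "\<eta> \<in> underS r \<xi>" for \<xi> \<eta> using that by (auto simp: V_def)
  have tot: "\<eta> \<in> underS r \<xi> \<or> \<xi> \<in> underS r \<eta>" if "\<xi> \<noteq> \<eta>" for \<xi> \<eta>
    using wo FU that unfolding order_on_defs total_on_def underS_def by blast
  obtain \<xi>\<^sub>0 where \<xi>\<^sub>0: "V \<xi>\<^sub>0 = topspace X"
  proof (rule ccontr)
    assume "\<not> thesis"
    then have "V \<xi> \<noteq> topspace X" for \<xi> using that by blast
    then have "\<exists>x. x \<in> W \<xi> - V \<xi>" for \<xi> using u(2)[OF openV] by (auto simp: W next_open_def)
    \<comment> \<open>Every stage would add a point, and distinct stages distinct points, which
      embeds \<open>'a set\<close> into \<open>'a\<close>.\<close>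
    then obtain p where p: "\<And>\<xi>. p \<xi> \<in> W \<xi> - V \<xi>" by metis
    have "inj p"
    proof (rule injI, rule ccontr)
      fix \<xi> \<eta> assume "p \<xi> = p \<eta>" "\<xi> \<noteq> \<eta>"
      then show False using tot[of \<xi> \<eta>] WV p[of \<xi>] p[of \<eta>] by auto
    qed
    then have "surj (inv p)" by (rule inj_imp_surj_inv)
    then have "inv p ` UNIV = Pow UNIV" by simp
    then show False using Cantors_theorem by blast
  qed
  \<comment> \<open>After the space is exhausted the differences are empty; those indices belong to
    \<open>S\<close> but add no points.\<close>
  define S where "S = {\<xi>. W \<xi> - V \<xi> \<subseteq> E}"
  have "E = (\<Union>\<xi>\<in>S. W \<xi> - V \<xi>)"
  proof (intro equalityI subsetI)
    fix x assume x: "x \<in> E"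
    then obtain \<eta> where "x \<in> W \<eta>" using \<xi>\<^sub>0 E by (auto simp: V_def)
    then obtain \<xi> where \<xi>: "x \<in> W \<xi>" "\<And>\<eta>. \<eta> \<in> underS r \<xi> \<Longrightarrow> x \<notin> W \<eta>"
      using Well_order_least[OF wo, of \<eta> "\<lambda>\<xi>. x \<in> W \<xi>"] FU by auto
    have xV: "x \<notin> V \<xi>" using \<xi>(2) by (auto simp: V_def)
    then have "V \<xi> \<noteq> topspace X" using x E by blast
    moreover from this have "W \<xi> - V \<xi> = u (V \<xi>) - V \<xi>" by (auto simp: W next_open_def)
    ultimately have "W \<xi> - V \<xi> \<subseteq> E" using u(3)[OF openV[of \<xi>]] x xV \<xi>(1) by auto
    then show "x \<in> (\<Union>\<xi>\<in>S. W \<xi> - V \<xi>)" using xV \<xi>(1) by (auto simp: S_def)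
  qed (auto simp: S_def)
  \<comment> \<open>Complements turn the growing open sets into decreasing closed ones.\<close>
  also have "\<dots> = (\<Union>\<xi>\<in>S. (topspace X - V \<xi>) - (topspace X - W \<xi>))"
    using openW[THEN openin_subset] by blast
  finally have eq: "E = (\<Union>\<xi>\<in>S. (topspace X - V \<xi>) - (topspace X - W \<xi>))" .
  show ?thesis
    unfolding eq
  proof (rule resolvable_in_Union_Diff[OF wo])
    show "topspace X - V \<eta> \<subseteq> topspace X - W \<xi>" if "(\<xi>, \<eta>) \<in> r" "\<xi> \<noteq> \<eta>" for \<xi> \<eta>
      using WV[of \<xi> \<eta>] that by (auto simp: underS_def)
  qed (use openV openW VW FU in auto)
qed

section \<open>Completely Baire spaces\<close>

text \<open>Otherwise every closed set contained in \<open>E\<close> or disjoint from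
  \<open>E\<close> has a trace on \<open>C\<close> that is nowhere dense in \<open>C\<close>. As
  \<open>E\<close> and its complement are F-sigma, countably many such traces cover the nonempty
  Baire space \<open>C\<close>, which is impossible.\<close>

lemma completely_Baire_homogeneous_part:
  assumes cB: "completely_Baire X" and dE: "delta02_in X E" and C: "closedin X C" "C \<noteq> {}"
  shows "\<exists>U. openin X U \<and> U \<inter> C \<noteq> {} \<and> (U \<inter> C \<subseteq> E \<or> U \<inter> C \<inter> E = {})"
proof (rule ccontr)
  assume no: "\<nexists>U. openin X U \<and> U \<inter> C \<noteq> {} \<and> (U \<inter> C \<subseteq> E \<or> U \<inter> C \<inter> E = {})"
  have CX: "C \<subseteq> topspace X" using C closedin_subset by blast
  have fs: "fsigma_in X E" "fsigma_in X (topspace X - E)"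
    using dE by (auto simp: delta02_in_def gdelta_in_fsigma_in)
  obtain P where P: "\<forall>n. closedin X (P n)" "\<forall>n. P n \<subseteq> P (Suc n)" "\<Union>(range P) = E"
    using fs(1) unfolding fsigma_in_ascending by (elim exE conjE)
  obtain Q where Q: "\<forall>n. closedin X (Q n)" "\<forall>n. Q n \<subseteq> Q (Suc n)" "\<Union>(range Q) = topspace X - E"
    using fs(2) unfolding fsigma_in_ascending by (elim exE conjE)
  define \<G> where "\<G> = (\<lambda>n. C - P n) ` UNIV \<union> (\<lambda>n. C - Q n) ` UNIV"
  have "openin (subtopology X C) G \<and> subtopology X C closure_of G = topspace (subtopology X C)"
    if G: "G \<in> \<G>" for G
  proof -
    obtain n where "G = C - P n \<or> G = C - Q n" using G by (auto simp: \<G>_def)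
    moreover have "P n \<subseteq> E" "Q n \<inter> E = {}" using P(3) Q(3) by blast+
    ultimately obtain K where K: "closedin X K" "K \<subseteq> E \<or> K \<inter> E = {}" "G = C - K"
      using P(1) Q(1) by metis
    have "G = (topspace X - K) \<inter> C" using K CX by blast
    then have "openin (subtopology X C) G" using K by (auto simp: openin_subtopology)
    moreover have "subtopology X C closure_of G = topspace (subtopology X C)"
      unfolding dense_intersects_open
    proof (intro allI impI)
      fix T assume T: "openin (subtopology X C) T \<and> T \<noteq> {}"
      then obtain U where U: "openin X U" "T = U \<inter> C" by (auto simp: openin_subtopology)
      have "\<not> (U \<inter> C \<subseteq> K)" using no U T K(2) by blast
      then show "G \<inter> T \<noteq> {}" using K(3) U(2) by blast
    qed
    ultimately show ?thesis by blast
  qed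
  moreover have "countable \<G>" by (simp add: \<G>_def)
  moreover have "Baire_space (subtopology X C)" using cB C by (simp add: completely_Baire_def)
  ultimately have "subtopology X C closure_of (topspace (subtopology X C) \<inter> \<Inter>\<G>) = topspace (subtopology X C)"
    unfolding Baire_space_def by blast
  moreover have "x \<notin> C \<inter> \<Inter>\<G>" for x
  proof
    assume x: "x \<in> C \<inter> \<Inter>\<G>"
    then have "x \<notin> \<Union>(range P)" "x \<notin> \<Union>(range Q)" by (auto simp: \<G>_def)
    then show False using x CX unfolding P(3) Q(3) by blast
  qed
  then have "C \<inter> \<Inter>\<G> = {}" by blast
  moreover have "topspace (subtopology X C) = C" using CX by auto
  ultimately show False using C by simp
qed

section \<open>Failure of the Baire property and countable closed sets without isolated
  points\<close>

lemma countable_perfect_not_Baire_space: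
  assumes t1: "t1_space X" and "countable (topspace X)" "topspace X \<noteq> {}"
    and iso: "\<And>x. x \<in> topspace X \<Longrightarrow> \<not> openin X {x}"
  shows "\<not> Baire_space X"
proof
  assume B: "Baire_space X"
  \<comment> \<open>The complements of single points are open because the space is T1 and dense
    because no point is isolated. There are countably many of them, and their intersection is
    empty.\<close>
  define \<G> where "\<G> = (\<lambda>x. topspace X - {x}) ` topspace X"
  have "openin X (topspace X - {x}) \<and> X closure_of (topspace X - {x}) = topspace X" if x: "x \<in> topspace X" for x
  proof
    show "openin X (topspace X - {x})" using t1 x by (auto simp: t1_space_closedin_singleton)
    show "X closure_of (topspace X - {x}) = topspace X"
      unfolding dense_intersects_open
    proof (intro allI impI)
      fix T assume T: "openin X T \<and> T \<noteq> {}"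
      then have "T \<noteq> {x}" using iso x by blast
      then show "(topspace X - {x}) \<inter> T \<noteq> {}" using T openin_subset[of X T] by blast
    qed
  qed
  then have "X closure_of (topspace X \<inter> \<Inter>\<G>) = topspace X"
    using B assms(2) unfolding Baire_space_def \<G>_def by (metis (no_types, lifting) countable_image imageE)
  moreover have "topspace X \<inter> \<Inter>\<G> = {}" by (auto simp: \<G>_def)
  ultimately show False using assms(3) by simp
qed

lemma homeomorphic_Rats_not_Baire_space:
  assumes "metrizable_space X" "X homeomorphic_space top_of_set (\<rat> :: real set)"
  shows "\<not> Baire_space X"
proof -
  obtain f where f: "homeomorphic_map X (top_of_set (\<rat> :: real set)) f"
    using assms(2) homeomorphic_space by blast
  have bij: "inj_on f (topspace X)" "f ` topspace X = \<rat>"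
    using homeomorphic_imp_injective_map[OF f] homeomorphic_imp_surjective_map[OF f] by auto
  show ?thesis
  proof (rule countable_perfect_not_Baire_space)
    show "t1_space X" using assms(1) by (rule metrizable_imp_t1_space)
    show "countable (topspace X)"
      using bij countable_rat by (metis countable_image_inj_on)
    show "topspace X \<noteq> {}" using bij Rats_0 by blast
    show "\<not> openin X {x}" if x: "x \<in> topspace X" for x
    proof
      assume "openin X {x}"
      then have "openin (top_of_set \<rat>) {f x}"
        using homeomorphic_map_openness_eq[OF f, of "{x}"] by simp
      then show False using Rats_not_isolated by blast
    qed
  qed
qed

lemma dense_open_Int:
  assumes "openin X G" "X closure_of G = topspace X" "openin X H" "X closure_of H = topspace X"
  shows "X closure_of (G \<inter> H) = topspace X"
  unfolding dense_intersects_open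
proof (intro allI impI)
  fix T assume T: "openin X T \<and> T \<noteq> {}"
  then have "G \<inter> T \<noteq> {}" using assms(2) unfolding dense_intersects_open by blast
  moreover have "openin X (G \<inter> T)" using T assms(1) by (simp add: openin_Int)
  ultimately have "H \<inter> (G \<inter> T) \<noteq> {}" using assms(4) unfolding dense_intersects_open by blast
  then show "G \<inter> H \<inter> T \<noteq> {}" by blast
qed

text \<open>In a closed \<open>C\<close> without the Baire property, some nonempty relatively open
  \<open>T\<close> misses the intersection of countably many dense open sets. Hurewicz's
  construction is carried out in a closed set \<open>Y\<close> inside \<open>T\<close>, which the
  complements of these sets cover.\<close>

lemma not_completely_Baire_imp_perfect:
  assumes "metrizable_space X" "\<not> completely_Baire X"
  obtains D where "closedin X D" "countable D" "D \<noteq> {}"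
    "\<And>x. x \<in> D \<Longrightarrow> \<not> openin (subtopology X D) {x}"
proof -
  obtain M d where "Metric_space M d" and X: "X = Metric_space.mtopology M d"
    using assms(1) by (auto simp: metrizable_space_def)
  interpret Metric_space M d by fact
  obtain C where C: "closedin mtopology C" and nB: "\<not> Baire_space (subtopology mtopology C)"
    using assms(2) by (auto simp: completely_Baire_def X)
  define Z where "Z = subtopology mtopology C"
  have CM: "C \<subseteq> M" using closedin_subset[OF C] by simp
  have tZ: "topspace Z = C" using CM by (auto simp: Z_def)
  obtain \<G> where \<G>: "countable \<G>" "\<And>G. G \<in> \<G> \<Longrightarrow> openin Z G \<and> Z closure_of G = C"
    and nd: "Z closure_of (C \<inter> \<Inter>\<G>) \<noteq> C"
    using nB unfolding Baire_space_def Z_def[symmetric] tZ by blast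
  \<comment> \<open>Inserting \<open>C\<close>, itself open and dense in \<open>Z\<close>, gives a
    nonempty family to enumerate even if \<open>\<G>\<close> is empty.\<close>
  define G where "G = from_nat_into (insert C \<G>)"
  have "openin Z C" "Z closure_of C = C" using openin_topspace[of Z] closure_of_topspace[of Z] tZ by auto
  then have G: "openin Z (G n)" "Z closure_of (G n) = C" for n
    using \<G>(2) from_nat_into[of "insert C \<G>" n] by (auto simp: G_def)
  have rangeG: "range G = insert C \<G>" using \<G>(1) by (simp add: G_def)
  \<comment> \<open>Finite intersections remain open and dense, and their complements in
    \<open>C\<close> increase with \<open>n\<close>.\<close>
  define H where "H n = (\<Inter>i\<le>n. G i)" for n
  have H: "openin Z (H n) \<and> Z closure_of (H n) = topspace Z" for n
  proof (induction n)
    case 0 then show ?case using G by (simp add: H_def tZ)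
  next
    case (Suc n)
    have "H (Suc n) = G (Suc n) \<inter> H n" by (simp add: H_def atMost_Suc)
    then show ?case using Suc G dense_open_Int[of Z "G (Suc n)" "H n"] by (simp add: tZ openin_Int)
  qed
  obtain T where T: "openin Z T" "T \<noteq> {}" "C \<inter> \<Inter>\<G> \<inter> T = {}"
    using nd dense_intersects_open[of Z "C \<inter> \<Inter>\<G>"] unfolding tZ by blast
  then obtain O' where O': "openin mtopology O'" "T = O' \<inter> C" by (auto simp: Z_def openin_subtopology)
  obtain x where x: "x \<in> O'" "x \<in> C" using T O' by blast
  obtain e where e: "e > 0" "mball x e \<subseteq> O'" using O'(1) x(1) unfolding openin_mtopology by blast
  \<comment> \<open>Halving the radius keeps the closure inside \<open>mball x e\<close>, hence
    inside \<open>T\<close>.\<close>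
  define Y where "Y = mtopology closure_of (C \<inter> mball x (e / 2))"
  have YC: "Y \<subseteq> C" unfolding Y_def using C by (intro closure_of_minimal) auto
  have "Y \<subseteq> mcball x (e / 2)" unfolding Y_def by (intro closure_of_minimal) auto
  moreover have "mcball x (e / 2) \<subseteq> mball x e" using e(1) by auto
  ultimately have YT: "Y \<subseteq> T" using YC e(2) O'(2) by blast
  have CB: "C \<inter> mball x (e / 2) \<subseteq> Y" unfolding Y_def by (intro closure_of_subset) (use CM in auto)
  show thesis
  proof (rule countable_perfect_closed_subset[of Y "\<lambda>n. C - H n"])
    show "Y \<noteq> {}" using CB x e(1) CM by auto
    show "closedin mtopology Y" by (simp add: Y_def)
    show "closedin mtopology (C - H n)" for n
    proof -
      have "closedin Z (C - H n)" using H[of n] tZ by (metis closedin_diff closedin_topspace)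
      then show ?thesis using C closedin_closed_subtopology unfolding Z_def by blast
    qed
    show "incseq (\<lambda>n. C - H n)" by (auto simp: incseq_def H_def)
    show "Y \<subseteq> (\<Union>n. C - H n)"
    proof
      fix y assume y: "y \<in> Y"
      then obtain K where "K \<in> insert C \<G>" "y \<notin> K" using YT YC T(3) by blast
      then obtain n where "y \<notin> G n" using rangeG by (metis imageE)
      then have "y \<notin> H n" by (auto simp: H_def)
      then show "y \<in> (\<Union>n. C - H n)" using y YC by blast
    qed
    show "\<exists>q\<in>Y. d y q < \<delta> \<and> q \<notin> C - H n" if y: "y \<in> Y" "0 < \<delta>" for n y \<delta>
    proof -
      have yM: "y \<in> M" using y YC CM by blast
      \<comment> \<open>As a limit of \<open>C \<inter> mball x (e / 2)\<close>, the point
        \<open>y\<close> has points of this relatively open set within \<delta>. Density of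
        \<open>H n\<close> then provides such a point outside \<open>C - H n\<close>.\<close>
      have "mball y \<delta> \<inter> (C \<inter> mball x (e / 2)) \<noteq> {}"
        using y yM unfolding Y_def in_closure_of by fastforce
      moreover have "openin Z (C \<inter> (mball y \<delta> \<inter> mball x (e / 2)))"
        unfolding Z_def by (intro openin_subtopology_Int2) auto
      moreover have "C \<inter> (mball y \<delta> \<inter> mball x (e / 2)) = mball y \<delta> \<inter> (C \<inter> mball x (e / 2))" by blast
      ultimately have "H n \<inter> (C \<inter> (mball y \<delta> \<inter> mball x (e / 2))) \<noteq> {}"
        using H[of n] dense_intersects_open[of Z "H n"] by metis
      then obtain q where "q \<in> H n" "q \<in> C \<inter> mball x (e / 2)" "q \<in> mball y \<delta>" by blast
      then show ?thesis using CB by (intro bexI[of _ q]) auto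
    qed
  next
    fix D assume D: "D \<subseteq> Y" "D \<noteq> {}" "countable D" "closedin mtopology D"
      "\<And>x e. x \<in> D \<Longrightarrow> 0 < e \<Longrightarrow> \<exists>y\<in>D. y \<noteq> x \<and> d x y < e"
    have DM: "D \<subseteq> M" using closedin_subset[OF D(4)] by simp
    have "\<not> openin (subtopology mtopology D) {x}" if x: "x \<in> D" for x
    proof
      assume "openin (subtopology mtopology D) {x}"
      then obtain T where T: "openin mtopology T" "{x} = T \<inter> D" by (auto simp: openin_subtopology)
      then obtain e where e: "e > 0" "mball x e \<subseteq> T" unfolding openin_mtopology by blast
      obtain y where y: "y \<in> D" "y \<noteq> x" "d x y < e" using D(5)[OF x e(1)] by blast
      then have "y \<in> mball x e" using x DM by auto
      then show False using e(2) T(2) y by blast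
    qed
    then show thesis using that[of D] D X by blast
  qed
qed

text \<open>Every subset of the countable set \<open>D\<close> is F-sigma, so any \<open>E\<close>
  inside \<open>D\<close> is both F-sigma and G-delta. Splitting by the parity of the number of ones
  makes \<open>E\<close> nontrivial on each nonempty relatively open part of
  \<open>D\<close>.\<close>

lemma perfect_imp_nonresolvable_delta02:
  assumes met: "metrizable_space X" and D: "closedin X D" "countable D" "D \<noteq> {}"
    and perfect: "\<And>x. x \<in> D \<Longrightarrow> \<not> openin (subtopology X D) {x}"
  obtains E where "E \<subseteq> topspace X" "delta02_in X E" "\<not> resolvable_in X E"
proof -
  have DX: "D \<subseteq> topspace X" using D closedin_subset by blast
  have tD: "topspace (subtopology X D) = D" using DX by auto
  obtain b where b: "seq_coding (subtopology X D) b"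
    using metrizable_seq_coding[OF metrizable_space_subtopology[OF met], of D] D(2,3) perfect
    unfolding tD by blast
  then have bij: "bij_betw b D fin_seqs" unfolding seq_coding_def tD by blast
  define E where "E = {x \<in> D. even (card {i. b x i})}"
  have cnt: "fsigma_in X K" if "K \<subseteq> D" for K
  proof -
    have "fsigma_in X (\<Union>((\<lambda>x. {x}) ` K))"
    proof (rule fsigma_in_Union)
      show "countable ((\<lambda>x. {x}) ` K)" using that D(2) countable_subset by blast
      show "fsigma_in X S" if "S \<in> (\<lambda>x. {x}) ` K" for S
        using that \<open>K \<subseteq> D\<close> DX metrizable_imp_t1_space[OF met]
        by (auto intro!: closed_imp_fsigma_in simp: t1_space_closedin_singleton)
    qed
    then show ?thesis by simp
  qed
  have "topspace X - E = (topspace X - D) \<union> (D - E)" using DX by (auto simp: E_def)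
  moreover have "fsigma_in X (topspace X - D)" using met D(1) by (intro open_imp_fsigma_in) auto
  ultimately have "fsigma_in X (topspace X - E)" using cnt[of "D - E"] by (simp add: fsigma_in_Un)
  then have dE: "delta02_in X E"
    using cnt[of E] DX by (auto simp: delta02_in_def gdelta_in_fsigma_in E_def)
  have "\<not> resolvable_in X E"
  proof
    assume "resolvable_in X E"
    then obtain U where U: "openin X U" "U \<inter> D \<noteq> {}" "U \<inter> D \<subseteq> E \<or> U \<inter> D \<inter> E = {}"
      using resolvable_in_homogeneous_part[OF _ DX D(3)] by blast
    obtain x where x: "x \<in> U \<inter> D" using U by blast
    have "openin (subtopology X D) (U \<inter> D)" using U by (auto simp: openin_subtopology)
    from seq_coding_openD[OF b this x] obtain n where
      n: "\<And>y. y \<in> D \<Longrightarrow> (\<forall>i<n. b y i = b x i) \<Longrightarrow> y \<in> U \<inter> D"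
      unfolding tD by metis
    have fin: "finite {i. b x i}" using bij x by (auto simp: bij_betw_def fin_seqs_def)
    \<comment> \<open>Setting a zero digit at a position \<open>N \<ge> n\<close> to one changes the
      parity but keeps the first \<open>n\<close> digits, so the new point stays in
      \<open>U\<close>.\<close>
    obtain N where N: "N \<ge> n" "\<not> b x N"
      using fin by (metis finite_nat_set_iff_bounded_le linorder_not_less max.cobounded1 max.cobounded2 mem_Collect_eq not_less_eq_eq)
    define \<beta> where "\<beta> = (b x)(N := True)"
    have S: "{i. \<beta> i} = insert N {i. b x i}" by (auto simp: \<beta>_def)
    then have "\<beta> \<in> fin_seqs" using fin by (simp add: fin_seqs_def)
    then obtain y where y: "y \<in> D" "b y = \<beta>" using bij unfolding bij_betw_def by (metis imageE)
    have "y \<in> U \<inter> D" using n[OF y(1)] N(1) by (simp add: y(2) \<beta>_def)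
    moreover have "card {i. b y i} = Suc (card {i. b x i})" using S N(2) fin by (simp add: y(2))
    then have "y \<in> E \<longleftrightarrow> x \<notin> E" using x y(1) by (simp add: E_def)
    ultimately show False using U(3) x by blast
  qed
  moreover have "E \<subseteq> topspace X" using DX by (auto simp: E_def)
  ultimately show thesis using dE that by blast
qed

theorem lemma6:
  fixes X :: "'a topology"
  assumes "metrizable_space X"
  shows "((\<nexists>C. closedin X C \<and> subtopology X C homeomorphic_space top_of_set (\<rat> :: real set))
            \<longleftrightarrow> completely_Baire X)
       \<and> (completely_Baire X
            \<longleftrightarrow> (\<forall>E. E \<subseteq> topspace X \<longrightarrow> (delta02_in X E \<longleftrightarrow> resolvable_in X E)))"
proof -
  have 1: "\<not> completely_Baire X"
    if "closedin X C" "subtopology X C homeomorphic_space top_of_set (\<rat> :: real set)" for C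
    using homeomorphic_Rats_not_Baire_space[OF metrizable_space_subtopology[OF assms]] that
    by (auto simp: completely_Baire_def)
  have 2: "delta02_in X E \<longleftrightarrow> resolvable_in X E" if "completely_Baire X" "E \<subseteq> topspace X" for E
    using homogeneous_imp_resolvable_in[OF that(2) completely_Baire_homogeneous_part[OF that(1)]]
      resolvable_in_imp_delta02_in[OF assms] by blast
  \<comment> \<open>One countable closed set without isolated points refutes both other conditions:
    it is a copy of the rationals, and it carries a set that is not resolvable.\<close>
  have 3: "(\<exists>C. closedin X C \<and> subtopology X C homeomorphic_space top_of_set (\<rat> :: real set)) \<and>
      (\<exists>E\<subseteq>topspace X. delta02_in X E \<and> \<not> resolvable_in X E)" if nB: "\<not> completely_Baire X"
  proof -
    obtain D where D: "closedin X D" "countable D" "D \<noteq> {}"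
      and perfect: "\<And>x. x \<in> D \<Longrightarrow> \<not> openin (subtopology X D) {x}"
      using not_completely_Baire_imp_perfect[OF assms nB] by blast
    have tD: "topspace (subtopology X D) = D" using closedin_subset[OF D(1)] by auto
    obtain b where "seq_coding (subtopology X D) b"
      using metrizable_seq_coding[OF metrizable_space_subtopology[OF assms], of D] D(2,3) perfect
      unfolding tD by blast
    moreover obtain c where "seq_coding (top_of_set (\<rat> :: real set)) c" by (rule Rats_seq_coding)
    ultimately have "subtopology X D homeomorphic_space top_of_set (\<rat> :: real set)"
      by (rule seq_coding_homeomorphic)
    moreover obtain E where "E \<subseteq> topspace X" "delta02_in X E" "\<not> resolvable_in X E"
      by (rule perfect_imp_nonresolvable_delta02[OF assms D perfect])
    ultimately show ?thesis using D(1) by blast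
  qed
  show ?thesis using 1 2 3 by blast
qed

end
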